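(* The inertia indices $(i_+,i_-,i_0)$ of the standard circular graphs $((0_l,w))$, $((0_{2k},-1,-1))$ and $((0_{2k},w_1,\dots,w_n))$, where $w\le 0$, $k,l\ge 0$, $n\ge 2$ and $w_i\le -2$ for all $i$, are as follows (with $k,l\ge 0$ such that the graph is nonempty). 1. $((0_{4l}))$: $(2l-1,2l-1,2)$; $\ ((0_{4l+1}))$: $(2l+1,2l,0)$; $\ ((0_{4l+2}))$: $(2l+1,2l+1,0)$; $\ ((0_{4l+3}))$: $(2l+1,2l+2,0)$. 2. $((0_{2k},w))$ with $w\le 0$: $(k,k+1,0)$, except for the graphs $((0_{4l},w))$ with $-2\le w\le 0$. $\ ((0_{4l},-1))$: $(2l+1,2l,0)$. $\ ((0_{4l+1},w))$ with $w\le 0$: $(2l+1,2l+1,0)$. $\ ((0_{4l+3},w))$ with $w<0$: $(2l+1,2l+2,1)$. 3. $((0_{4l},-1,-1))$: $(2l+1,2l+1,0)$. $\ ((0_{4l+2},-1,-1))$: $(2l+1,2l+3,0)$. $\ ((0_{2k},w_1,\dots,w_n))$ with all $w_i\le -2$: $(k,k+n,0)$, except for the graphs $((0_{4l},(-2)_n))$. $\ ((0_{4l},(-2)_n))$: $(2l,2l+n-1,1)$.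
   Context: $((w_1,\dots,w_m))$ denotes the circular weighted graph (cycle) with cyclically ordered vertices $v_1,\dots,v_m$ of integer weights $w_1,\dots,w_m$; inside brackets $(a)_m$ denotes $m$ consecutive entries $a$, and $0_m=(0)_m$. The associated symmetric bilinear form $I(\Gamma)=(v_i.v_j)$ has $v_i.v_i$ equal to the weight of $v_i$ and, for $i\neq j$, $v_i.v_j$ equal to the number of edges joining $v_i$ and $v_j$, with the following conventions for short cycles: for $m=2$ the two vertices are joined by two edges, so $v_1.v_2=2$; for $m=1$ the vertex has a loop and $I(((w)))$ is the $1\times1$ matrix $(w+2)$. The inertia indices $(i_+,i_-,i_0)$ are the numbers of positive, negative and zero eigenvalues of $I(\Gamma)$. *)

theory Defs
  imports "Jordan_Normal_Form.Char_Poly"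
begin

text \<open>
  A circular graph is represented by the list of its integer weights in cyclic order;
  vertex \<open>i\<close> is the one at list position \<open>i\<close>. The edges are indexed by \<open>e < m\<close>, the edge
  \<open>e\<close> having the endpoints \<open>e\<close> and \<open>e + 1 mod m\<close>. Thus distinct vertices are joined by
  two edges if \<open>m = 2\<close>, and the only edge is a loop if \<open>m = 1\<close>.
\<close>

definition num_edges :: "nat \<Rightarrow> nat \<Rightarrow> nat \<Rightarrow> nat" where
  "num_edges m i j = card {e. e < m \<and> {e, Suc e mod m} = {i, j}}"

text \<open>By convention, the loop of the one-vertex graph contributes 2 to the self-intersection.\<close>

definition circ_form :: "int list \<Rightarrow> int mat" where
  "circ_form ws = mat (length ws) (length ws) (\<lambda>(i, j).
     if i = j then (if length ws = 1 then ws ! i + 2 else ws ! i)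
     else int (num_edges (length ws) i j))"

text \<open>
  Eigenvalues are counted with multiplicity, as roots of the characteristic polynomial.
  All of them are real for the symmetric matrices considered, so none is missed over the reals.
\<close>

definition num_eigenvalues :: "(real \<Rightarrow> bool) \<Rightarrow> real mat \<Rightarrow> nat" where
  "num_eigenvalues P A = size (filter_mset P (proots (char_poly A)))"

definition inertia :: "real mat \<Rightarrow> nat \<times> nat \<times> nat" where
  "inertia A = (num_eigenvalues (\<lambda>x. x > 0) A,
                num_eigenvalues (\<lambda>x. x < 0) A,
                num_eigenvalues (\<lambda>x. x = 0) A)"

definition circ_inertia :: "int list \<Rightarrow> nat \<times> nat \<times> nat" where
  "circ_inertia ws = inertia (map_mat real_of_int (circ_form ws))"

abbreviation zeros :: "nat \<Rightarrow> int list" where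
  "zeros m \<equiv> replicate m 0"

end

theory Submission
  imports Defs
begin

text \<open>
  Consider cycles in which one edge carries a sign \<open>s\<close>. Two neighbouring vertices
  of weight 0 span a hyperbolic plane of inertia \<open>(1, 1, 0)\<close>; projecting the rest of the cycle
  onto its orthogonal complement closes the shorter cycle up again by an edge of sign \<open>-s\<close>.
  Hence a block of \<open>2k\<close> zeros contributes \<open>(k, k, 0)\<close> and multiplies the sign of the
  closing edge by \<open>(-1)^k\<close>. What remains has at most two vertices or has all weights at most
  \<open>-2\<close>; in the latter case minus the form is a sum of squares,
  \<open>\<Sum>(-w\<^sub>i - 2) x\<^sub>i\<^sup>2 + \<Sum>(x\<^sub>i - x\<^sub>i\<^sub>+\<^sub>1)\<^sup>2 + (x\<^sub>n - s x\<^sub>1)\<^sup>2\<close>, which vanishes for a nonzero vector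
  only if \<open>s = 1\<close> and all weights are \<open>-2\<close>.
\<close>

section \<open>The spectral theorem for real symmetric matrices\<close>

lemma scalar_prod_self_eq_0_iff:
  fixes v :: "real vec"
  assumes "v \<in> carrier_vec n"
  shows "v \<bullet> v = 0 \<longleftrightarrow> v = 0\<^sub>v n"
  using conjugate_square_eq_0_vec[OF assms] by simp

text \<open>The characteristic polynomial splits over the complex numbers, so it has a complex root
  \<open>a\<close>. Moving the symmetric matrix across the Hermitian product shows that
  \<open>a\<close> is its own conjugate. A real root has a real eigenvector, which is then
  normalised.\<close>

lemma symmetric_mat_unit_eigenvector:
  fixes A :: "real mat"
  assumes A: "A \<in> carrier_mat n n" and sym: "A\<^sup>T = A" and "0 < n"
  obtains v \<mu> where "v \<in> carrier_vec n" "v \<bullet> v = 1" "A *\<^sub>v v = \<mu> \<cdot>\<^sub>v v"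
proof -
  let ?B = "map_mat complex_of_real A"
  have B: "?B \<in> carrier_mat n n" using A by simp
  have symB: "?B\<^sup>T = ?B" using sym by (simp add: map_mat_transpose)
  obtain as where as: "char_poly ?B = (\<Prod>a\<leftarrow>as. [:- a, 1:])" "length as = n"
    using char_poly_factorized[OF B] by blast
  with \<open>0 < n\<close> obtain a where "a \<in> set as" by (cases as) auto
  then have "poly (char_poly ?B) a = 0"
    unfolding as by (induction as) auto
  then obtain v where v: "v \<in> carrier_vec n" "v \<noteq> 0\<^sub>v n" "?B *\<^sub>v v = a \<cdot>\<^sub>v v"
    using eigenvalue_root_char_poly[OF B] B unfolding eigenvalue_def eigenvector_def by auto
  \<comment> \<open>The entries of \<open>?B\<close> are real, so conjugation passes through
    it.\<close>
  have "conjugate (?B *\<^sub>v v) = ?B *\<^sub>v conjugate v"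
    using A v(1) by (intro eq_vecI) (auto simp: scalar_prod_def)
  then have Bc: "?B *\<^sub>v conjugate v = cnj a \<cdot>\<^sub>v conjugate v"
    using v by (simp add: conjugate_smult_vec)
  have "a * (v \<bullet>c v) = (?B *\<^sub>v v) \<bullet>c v"
    using v by simp
  also have "\<dots> = v \<bullet> (?B *\<^sub>v conjugate v)"
    using transpose_vec_mult_scalar[OF B, of "conjugate v" v] v(1) symB by simp
  also have "\<dots> = cnj a * (v \<bullet>c v)"
    using v(1) by (simp add: Bc)
  finally have "a = cnj a"
    using v by simp
  then have a: "a = complex_of_real (Re a)"
    by (simp add: complex_eq_iff)
  have "complex_of_real (poly (char_poly A) (Re a)) = poly (char_poly ?B) a"
    by (subst a) (simp add: of_real_hom.char_poly_hom[OF A])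
  then have "poly (char_poly A) (Re a) = 0"
    using \<open>poly (char_poly ?B) a = 0\<close> by simp
  then obtain w where w: "w \<in> carrier_vec n" "w \<noteq> 0\<^sub>v n" "A *\<^sub>v w = Re a \<cdot>\<^sub>v w"
    using eigenvalue_root_char_poly[OF A] A unfolding eigenvalue_def eigenvector_def by auto
  have "w \<bullet> w > 0"
    using w conjugate_square_greater_0_vec[OF w(1)] by simp
  show ?thesis
  proof
    let ?v = "(1 / sqrt (w \<bullet> w)) \<cdot>\<^sub>v w"
    show "?v \<in> carrier_vec n" using w by simp
    show "?v \<bullet> ?v = 1" using w \<open>w \<bullet> w > 0\<close> by (simp add: power2_eq_square)
    show "A *\<^sub>v ?v = Re a \<cdot>\<^sub>v ?v"
      using w A by (simp add: mult_mat_vec smult_smult_assoc mult.commute)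
  qed
qed

text \<open>The reflection in the hyperplane orthogonal to \<open>v - unit_vec n 0\<close> exchanges
  these two unit vectors. If they coincide, there is no such hyperplane and the identity
  serves.\<close>

lemma householder_reflection:
  fixes v :: "real vec"
  assumes v: "v \<in> carrier_vec n" and unit: "v \<bullet> v = 1" and n: "0 < n"
  obtains H where "H \<in> carrier_mat n n" "H\<^sup>T = H" "H * H = 1\<^sub>m n" "H *\<^sub>v unit_vec n 0 = v"
proof (cases "v = unit_vec n 0")
  case True
  then show ?thesis using that[of "1\<^sub>m n"] by simp
next
  case False
  define u where "u = v - unit_vec n 0"
  have u: "u \<in> carrier_vec n" using v by (simp add: u_def)
  define s where "s = u \<bullet> u"
  have "u \<noteq> 0\<^sub>v n"
  proof
    assume u0: "u = 0\<^sub>v n"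
    have "v $ i = unit_vec n 0 $ i" if "i < n" for i
      using v that arg_cong[OF u0, of "\<lambda>w. w $ i"] by (simp add: u_def)
    then have "v = unit_vec n 0" using v by (intro eq_vecI) auto
    then show False using False by simp
  qed
  then have s0: "s \<noteq> 0"
    using scalar_prod_self_eq_0_iff[OF u] by (simp add: s_def)
  \<comment> \<open>Both vectors have length 1, so the squared length of their difference is 2 minus
    twice their scalar product, and the latter is the first entry of \<open>v\<close>.\<close>
  have s: "s = 2 - 2 * v $ 0"
    using v n unit unfolding s_def u_def
    by (simp add: minus_scalar_prod_distrib[of _ n] scalar_prod_minus_distrib[of _ n])
  have u0: "u $ 0 = - s / 2"
    using v n by (simp add: u_def s)
  have ssum: "(\<Sum>k = 0..<n. u $ k * u $ k) = s"
    using u by (simp add: s_def scalar_prod_def)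
  define H where "H = mat n n (\<lambda>(i, j). of_bool (i = j) - 2 / s * u $ i * u $ j)"
  show ?thesis
  proof
    show "H \<in> carrier_mat n n" by (simp add: H_def)
    show "H\<^sup>T = H" by (rule eq_matI) (auto simp: H_def)
    show "H * H = 1\<^sub>m n"
    proof (rule eq_matI)
      fix i j assume "i < dim_row (1\<^sub>m n :: real mat)" "j < dim_col (1\<^sub>m n :: real mat)"
      then have ij: "i < n" "j < n" by auto
      have "(H * H) $$ (i, j) = (\<Sum>k = 0..<n. (of_bool (i = k) - 2 / s * u $ i * u $ k) *
          (of_bool (k = j) - 2 / s * u $ k * u $ j))"
        using ij by (simp add: H_def scalar_prod_def)
      \<comment> \<open>The first two sums collect the terms with a Kronecker delta. The third
        equals \<open>4 / s * u $ i * u $ j\<close> because the squares of the entries of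
        \<open>u\<close> add up to \<open>s\<close>, and it cancels the two mixed terms.\<close>
      also have "\<dots> = (\<Sum>k = 0..<n. (if k = i then of_bool (i = j) - 2 / s * u $ i * u $ j else 0))
          - (\<Sum>k = 0..<n. if k = j then 2 / s * u $ i * u $ j else 0)
          + (\<Sum>k = 0..<n. (4 / s^2 * u $ i * u $ j) * (u $ k * u $ k))"
        unfolding sum_subtractf[symmetric] sum.distrib[symmetric]
        by (rule sum.cong) (auto simp: algebra_simps power2_eq_square)
      also have "\<dots> = of_bool (i = j)"
        using ij s0 unfolding sum_distrib_left[symmetric] ssum
        by (simp add: power2_eq_square)
      finally show "(H * H) $$ (i, j) = 1\<^sub>m n $$ (i, j)"
        using ij by simp
    qed (auto simp: H_def)
    show "H *\<^sub>v unit_vec n 0 = v"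
    proof (rule eq_vecI)
      fix i assume "i < dim_vec v"
      then have i: "i < n" using v by simp
      then have "(H *\<^sub>v unit_vec n 0) $ i = H $$ (i, 0)"
        using n by (simp add: H_def)
      also have "\<dots> = v $ i"
        using i n v s0 by (simp add: H_def u0) (auto simp: u_def s field_simps)
      finally show "(H *\<^sub>v unit_vec n 0) $ i = v $ i" .
    qed (use v in \<open>simp add: H_def\<close>)
  qed
qed

lemma mult_block_diag_mat:
  fixes A B C D :: "'a :: semiring_0 mat"
  assumes "A \<in> carrier_mat k k" "B \<in> carrier_mat k k" "C \<in> carrier_mat m m" "D \<in> carrier_mat m m"
  shows "four_block_mat A (0\<^sub>m k m) (0\<^sub>m m k) C * four_block_mat B (0\<^sub>m k m) (0\<^sub>m m k) D
    = four_block_mat (A * B) (0\<^sub>m k m) (0\<^sub>m m k) (C * D)"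
proof -
  have "A * B \<in> carrier_mat k k" "C * D \<in> carrier_mat m m" using assms by auto
  then show ?thesis
    using assms
    by (simp add: mult_four_block_mat[of _ k k _ m _ m _ _ k _ m]
        left_mult_zero_mat[of _ m] left_mult_zero_mat[of _ k])
qed

text \<open>Induction on the dimension. Conjugating by a Householder reflection that carries the
  first basis vector to a unit eigenvector clears the first column off the diagonal, and by symmetry
  the first row. The induction hypothesis diagonalises the remaining block.\<close>

lemma real_spectral_theorem:
  fixes A :: "real mat"
  assumes "A \<in> carrier_mat n n" and "A\<^sup>T = A"
  obtains Q d where "Q \<in> carrier_mat n n" "Q\<^sup>T * Q = 1\<^sub>m n" "A = Q * mat_diag n d * Q\<^sup>T"
proof -
  have "\<exists>Q d. Q \<in> carrier_mat n n \<and> Q\<^sup>T * Q = 1\<^sub>m n \<and> A = Q * mat_diag n d * Q\<^sup>T"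
    using assms
  proof (induction n arbitrary: A)
    case 0
    then show ?case
      by (intro exI[of _ "1\<^sub>m 0"] exI[of _ "\<lambda>_. 0"]) (auto intro!: eq_matI)
  next
    case (Suc m)
    let ?n = "Suc m"
    note A = Suc.prems(1)
    obtain v \<mu> where v: "v \<in> carrier_vec ?n" "v \<bullet> v = 1" "A *\<^sub>v v = \<mu> \<cdot>\<^sub>v v"
      by (rule symmetric_mat_unit_eigenvector[OF Suc.prems]) auto
    obtain H where H: "H \<in> carrier_mat ?n ?n" "H\<^sup>T = H" "H * H = 1\<^sub>m ?n" "H *\<^sub>v unit_vec ?n 0 = v"
      by (rule householder_reflection[OF v(1,2)]) auto
    define B where "B = H * A * H"
    have B: "B \<in> carrier_mat ?n ?n" using A H by (simp add: B_def)
    have symB: "B\<^sup>T = B"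
      using A H Suc.prems(2) by (simp add: B_def transpose_mult[of _ ?n ?n _ ?n])
    have e: "unit_vec ?n 0 \<in> carrier_vec ?n" by simp
    have "H *\<^sub>v v = H * H *\<^sub>v unit_vec ?n 0"
      unfolding H(4)[symmetric] using H(1) e by (simp add: assoc_mult_mat_vec[of _ ?n ?n _ ?n])
    \<comment> \<open>A reflection is an involution, so it also carries the eigenvector back to the
      basis vector.\<close>
    then have Hv: "H *\<^sub>v v = unit_vec ?n 0"
      using H e by simp
    have "B *\<^sub>v unit_vec ?n 0 = H *\<^sub>v (A *\<^sub>v (H *\<^sub>v unit_vec ?n 0))"
      unfolding B_def using A H(1) e mult_carrier_mat[OF H(1) A]
      by (simp add: assoc_mult_mat_vec[of _ ?n ?n _ ?n] del: assoc_mult_mat)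
    also have "\<dots> = \<mu> \<cdot>\<^sub>v unit_vec ?n 0"
      using H v by (simp add: mult_mat_vec Hv)
    finally have Be: "B *\<^sub>v unit_vec ?n 0 = \<mu> \<cdot>\<^sub>v unit_vec ?n 0" .
    have col: "B $$ (i, 0) = (if i = 0 then \<mu> else 0)" if i: "i < ?n" for i
    proof -
      have "B $$ (i, 0) = (B *\<^sub>v unit_vec ?n 0) $ i"
        using i B by (simp add: scalar_prod_right_unit[of _ ?n])
      also have "\<dots> = (if i = 0 then \<mu> else 0)"
        unfolding Be using i by simp
      finally show ?thesis .
    qed
    have row: "B $$ (0, i) = (if i = 0 then \<mu> else 0)" if "i < ?n" for i
      using col[OF that] arg_cong[OF symB, of "\<lambda>M. M $$ (i, 0)"] B that by simp
    define C where "C = mat m m (\<lambda>(i, j). B $$ (Suc i, Suc j))"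
    have C: "C \<in> carrier_mat m m" by (simp add: C_def)
    have symC: "C\<^sup>T = C"
    proof (rule eq_matI)
      fix i j assume "i < dim_row C" "j < dim_col C"
      then show "C\<^sup>T $$ (i, j) = C $$ (i, j)"
        using arg_cong[OF symB, of "\<lambda>M. M $$ (Suc i, Suc j)"] B by (simp add: C_def)
    qed (auto simp: C_def)
    let ?M = "mat 1 1 (\<lambda>_. \<mu>)"
    have B4: "B = four_block_mat ?M (0\<^sub>m 1 m) (0\<^sub>m m 1) C"
      by (rule eq_matI) (use B in \<open>auto simp: C_def col row\<close>)
    obtain R d where R: "R \<in> carrier_mat m m" "R\<^sup>T * R = 1\<^sub>m m" "C = R * mat_diag m d * R\<^sup>T"
      using Suc.IH[OF C symC] by blast
    define S where "S = four_block_mat (1\<^sub>m 1) (0\<^sub>m 1 m) (0\<^sub>m m 1) R"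
    define d' where "d' i = (case i of 0 \<Rightarrow> \<mu> | Suc i \<Rightarrow> d i)" for i
    have S: "S \<in> carrier_mat ?n ?n"
      using R four_block_carrier_mat[of "1\<^sub>m 1" 1 1 R m m] by (simp add: S_def)
    have ST: "S\<^sup>T = four_block_mat (1\<^sub>m 1) (0\<^sub>m 1 m) (0\<^sub>m m 1) R\<^sup>T"
      unfolding S_def using R by (subst transpose_four_block_mat[of _ 1 1 _ m _ m]) auto
    have SS: "S\<^sup>T * S = 1\<^sub>m ?n"
      unfolding ST unfolding S_def using R
      by (simp add: mult_block_diag_mat[of _ 1 _ _ m, simplified])
    have D: "mat_diag ?n d' = four_block_mat ?M (0\<^sub>m 1 m) (0\<^sub>m m 1) (mat_diag m d)"
      by (rule eq_matI) (auto simp: mat_diag_def d'_def split: nat.split)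
    have "S * mat_diag ?n d' = four_block_mat (1\<^sub>m 1 * ?M) (0\<^sub>m 1 m) (0\<^sub>m m 1) (R * mat_diag m d)"
      unfolding D S_def by (rule mult_block_diag_mat) (use R in auto)
    then have "S * mat_diag ?n d' * S\<^sup>T
        = four_block_mat (1\<^sub>m 1 * ?M * 1\<^sub>m 1) (0\<^sub>m 1 m) (0\<^sub>m m 1) (R * mat_diag m d * R\<^sup>T)"
      unfolding ST by (simp only:) (rule mult_block_diag_mat, use R in auto)
    then have "S * mat_diag ?n d' * S\<^sup>T = B"
      unfolding B4 R(3) by simp
    moreover have "H * B * H = A"
    proof -
      have "H * B * H = (H * H) * A * (H * H)"
        unfolding B_def using A H(1) by (simp add: assoc_mult_mat[of _ ?n ?n _ ?n _ ?n])
      then show ?thesis using A H by simp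
    qed
    ultimately have "A = H * (S * mat_diag ?n d' * S\<^sup>T) * H" by simp
    also have "\<dots> = (H * S) * mat_diag ?n d' * (S\<^sup>T * H)"
      using H(1) S by (simp add: assoc_mult_mat[of _ ?n ?n _ ?n _ ?n] mult_carrier_mat[of _ ?n ?n _ ?n])
    finally have "A = (H * S) * mat_diag ?n d' * (H * S)\<^sup>T"
      using H S by (simp add: transpose_mult[of _ ?n ?n _ ?n])
    moreover have "(H * S)\<^sup>T * (H * S) = 1\<^sub>m ?n"
    proof -
      have "(H * S)\<^sup>T * (H * S) = S\<^sup>T * ((H * H) * S)"
        using H(1,2) S by (simp add: transpose_mult[of _ ?n ?n _ ?n] assoc_mult_mat[of _ ?n ?n _ ?n _ ?n])
      then show ?thesis using H S SS by simp
    qed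
    ultimately show ?case using H(1) S by (intro exI[of _ "H * S"] exI[of _ d']) simp
  qed
  then show ?thesis using that by blast
qed

section \<open>Inertia of real symmetric matrices\<close>

lemma symmetric_mat_congruence:
  assumes "A \<in> carrier_mat n n" "A\<^sup>T = A" "P \<in> carrier_mat n m"
  shows "(P\<^sup>T * A * P)\<^sup>T = P\<^sup>T * (A :: 'a :: comm_semiring_0 mat) * P"
  using assms mult_carrier_mat[OF assms(1,3)]
  by (simp add: transpose_mult[of _ m n _ m] transpose_mult[of _ n n _ m])

text \<open>The transpose of \<open>Q\<close> is its inverse, so the product is similar to the
  diagonal matrix and has the same characteristic polynomial, with the values \<open>d i\<close> as
  its roots. Counting eigenvalues thus becomes counting indices.\<close>

lemma num_eigenvalues_orthogonal_diag:
  assumes Q: "Q \<in> carrier_mat n n" and QTQ: "Q\<^sup>T * Q = 1\<^sub>m n"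
  shows "num_eigenvalues P (Q * mat_diag n d * Q\<^sup>T) = card {i. i < n \<and> P (d i)}"
proof -
  let ?A = "Q * mat_diag n d * Q\<^sup>T"
  have "Q * Q\<^sup>T = 1\<^sub>m n"
    using mat_mult_left_right_inverse[OF _ Q QTQ] Q by simp
  then have "similar_mat ?A (mat_diag n d)"
    using Q QTQ mult_carrier_mat[OF mult_carrier_mat[OF Q mat_diag_dim[of n d]], of "Q\<^sup>T" n]
    by (intro similar_matI[of _ _ Q "Q\<^sup>T" n]) auto
  then have "char_poly ?A = char_poly (mat_diag n d)"
    by (rule char_poly_similar)
  also have "\<dots> = (\<Prod>a\<leftarrow>map d [0..<n]. [:- a, 1:])"
    by (subst char_poly_upper_triangular[OF mat_diag_dim])
      (auto simp: upper_triangular_def mat_diag_def diag_mat_def intro!: arg_cong[of _ _ prod_list])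
  finally have cp: "char_poly ?A = (\<Prod>a\<leftarrow>map d [0..<n]. [:- a, 1:])" .
  have "proots (\<Prod>a\<leftarrow>xs. [:- a, 1:]) = mset xs" for xs :: "real list"
  proof (induction xs)
    case (Cons a xs)
    have "(\<Prod>a\<leftarrow>xs. [:- a, 1:]) \<noteq> 0" by (auto simp: prod_list_zero_iff)
    then have "proots (\<Prod>a\<leftarrow>a # xs. [:- a, 1:]) = proots [:- a, 1:] + proots (\<Prod>a\<leftarrow>xs. [:- a, 1:])"
      unfolding list.map prod_list.Cons by (intro proots_mult) auto
    then show ?case using Cons.IH by simp
  qed simp
  then have "num_eigenvalues P ?A = length (filter P (map d [0..<n]))"
    unfolding num_eigenvalues_def cp by (metis mset_filter size_mset)
  also have "\<dots> = card {i. i < n \<and> P (d i)}"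
    unfolding length_filter_conv_card by (auto intro!: arg_cong[of _ _ card])
  finally show ?thesis .
qed

lemma num_eigenvalues_mat_diag: "num_eigenvalues P (mat_diag n d) = card {i. i < n \<and> P (d i)}"
  using num_eigenvalues_orthogonal_diag[of "1\<^sub>m n" n P d]
  by (simp add: left_mult_one_mat[OF mat_diag_dim] right_mult_one_mat[OF mat_diag_dim])

text \<open>By the spectral theorem there are \<open>n\<close> real eigenvalues with multiplicity,
  and each has exactly one sign. Later this yields one inertia index from bounds on the
  others.\<close>

lemma num_eigenvalues_sum:
  assumes "A \<in> carrier_mat n n" "A\<^sup>T = A"
  shows "num_eigenvalues (\<lambda>x. x > 0) A + num_eigenvalues (\<lambda>x. x < 0) A
    + num_eigenvalues (\<lambda>x. x = 0) A = n"
proof -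
  obtain Q d where Q: "Q \<in> carrier_mat n n" "Q\<^sup>T * Q = 1\<^sub>m n" "A = Q * mat_diag n d * Q\<^sup>T"
    by (rule real_spectral_theorem[OF assms])
  have "{..<n} = ({i. i < n \<and> d i > 0} \<union> {i. i < n \<and> d i < 0}) \<union> {i. i < n \<and> d i = 0}"
    by auto
  then have "n = card (({i. i < n \<and> d i > 0} \<union> {i. i < n \<and> d i < 0}) \<union> {i. i < n \<and> d i = 0})"
    by (metis card_lessThan)
  then show ?thesis
    unfolding Q(3) num_eigenvalues_orthogonal_diag[OF Q(1,2)]
    by (subst (asm) card_Un_disjoint, (auto)[3], subst (asm) card_Un_disjoint) auto
qed

section \<open>Sylvester's law of inertia\<close>

text \<open>Fewer equations than unknowns. Both are indexed by finite sets, so that sets of indices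
  with positive coefficient can be inserted directly; the solution is extended by 0 outside
  \<open>S\<close>.\<close>

lemma homogeneous_system_nontrivial_solution:
  fixes f :: "'a \<Rightarrow> 'b \<Rightarrow> 'c :: idom"
  assumes fin: "finite S" "finite T" and less: "card T < card S"
  obtains x where "\<exists>j\<in>S. x j \<noteq> 0" "\<And>j. j \<notin> S \<Longrightarrow> x j = 0"
    "\<And>i. i \<in> T \<Longrightarrow> (\<Sum>j\<in>S. f i j * x j) = 0"
proof -
  define p where "p = card S"
  define q where "q = card T"
  obtain h where h: "bij_betw h {0..<p} S"
    using ex_bij_betw_nat_finite[OF fin(1)] by (auto simp: p_def)
  obtain g where g: "bij_betw g {0..<q} T"
    using ex_bij_betw_nat_finite[OF fin(2)] by (auto simp: q_def)
  \<comment> \<open>Padding the coefficient matrix with zero rows makes it square and singular.\<close>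
  define M where "M = mat p p (\<lambda>(i, j). if i < q then f (g i) (h j) else 0)"
  have M: "M \<in> carrier_mat p p" by (simp add: M_def)
  have qp: "q < p" using less by (simp add: p_def q_def)
  have "M = mat\<^sub>r p p (\<lambda>i. if i = q then 0\<^sub>v p else row M i)"
    by (rule eq_matI) (auto simp: M_def)
  then have "det M = 0"
    using det_row_0[OF qp, of "row M"] M by simp
  then obtain v where v: "v \<in> carrier_vec p" "v \<noteq> 0\<^sub>v p" "M *\<^sub>v v = 0\<^sub>v p"
    using det_0_iff_vec_prod_zero[OF M] by blast
  define x where "x j = (if j \<in> S then v $ (inv_into {0..<p} h j) else 0)" for j
  have xh: "x (h k) = v $ k" if "k < p" for k
    using that h bij_betwE[OF h] by (auto simp: x_def bij_betw_def)
  show ?thesis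
  proof
    from v obtain k where "k < p" "v $ k \<noteq> 0" by force
    then show "\<exists>j\<in>S. x j \<noteq> 0"
      using xh bij_betwE[OF h] by (intro bexI[of _ "h k"]) auto
    show "x j = 0" if "j \<notin> S" for j using that by (simp add: x_def)
    show "(\<Sum>j\<in>S. f i j * x j) = 0" if "i \<in> T" for i
    proof -
      have "i \<in> g ` {0..<q}" using that bij_betw_imp_surj_on[OF g] by simp
      then obtain k where k: "k < q" "i = g k" by auto
      have "(\<Sum>j\<in>S. f i j * x j) = (\<Sum>j = 0..<p. f i (h j) * x (h j))"
        by (rule sum.reindex_bij_betw[OF h, symmetric])
      also have "\<dots> = (M *\<^sub>v v) $ k"
        using k(1) qp v(1) unfolding k(2) by (simp add: M_def scalar_prod_def xh)
      also have "\<dots> = 0" using v k qp by simp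
      finally show ?thesis .
    qed
  qed
qed

text \<open>If there were more positive \<open>e j\<close> than positive \<open>d i\<close>, some
  nonzero \<open>x\<close> supported on the former would annihilate every linear form
  \<open>r i\<close> belonging to the latter. The left side would be positive at \<open>x\<close>
  and the right side at most 0.\<close>

lemma card_pos_coeffs_le:
  fixes d e :: "nat \<Rightarrow> real"
  assumes eq: "\<And>x. (\<Sum>j<m. e j * (x j)\<^sup>2) = (\<Sum>i<n. d i * (\<Sum>j<m. r i j * x j)\<^sup>2)"
  shows "card {j. j < m \<and> e j > 0} \<le> card {i. i < n \<and> d i > 0}"
proof (rule ccontr)
  let ?S = "{j. j < m \<and> e j > 0}" and ?T = "{i. i < n \<and> d i > 0}"
  assume "\<not> card ?S \<le> card ?T"
  then have less: "card ?T < card ?S" by simp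
  have fin: "finite ?S" "finite ?T" by auto
  obtain x where x: "\<exists>j\<in>?S. x j \<noteq> 0" "\<And>j. j \<notin> ?S \<Longrightarrow> x j = 0"
    "\<And>i. i \<in> ?T \<Longrightarrow> (\<Sum>j\<in>?S. r i j * x j) = 0"
    by (rule homogeneous_system_nontrivial_solution[OF fin less, of r]) blast
  obtain k where k: "k < m" "e k > 0" "x k \<noteq> 0" using x(1) by blast
  have "0 < (\<Sum>j<m. e j * (x j)\<^sup>2)"
  proof (rule sum_pos2[of _ k])
    show "0 \<le> e j * (x j)\<^sup>2" if "j \<in> {..<m}" for j
      using x(2)[of j] that by (cases "e j > 0") auto
  qed (use k in auto)
  moreover have "(\<Sum>i<n. d i * (\<Sum>j<m. r i j * x j)\<^sup>2) \<le> 0"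
  proof (rule sum_nonpos)
    fix i assume i: "i \<in> {..<n}"
    have "(\<Sum>j\<in>?S. r i j * x j) = (\<Sum>j<m. r i j * x j)"
      using x(2) by (intro sum.mono_neutral_left) auto
    then show "d i * (\<Sum>j<m. r i j * x j)\<^sup>2 \<le> 0"
      using x(3)[of i] i by (cases "d i > 0") (auto simp: mult_nonpos_nonneg)
  qed
  ultimately show False using eq[of x] by simp
qed

lemma scalar_prod_mat_diag:
  fixes v :: "real vec"
  assumes "v \<in> carrier_vec n"
  shows "v \<bullet> (mat_diag n d *\<^sub>v v) = (\<Sum>i<n. d i * (v $ i)\<^sup>2)"
proof -
  have "(mat_diag n d *\<^sub>v v) $ i = d i * v $ i" if "i < n" for i
  proof -
    have "(mat_diag n d *\<^sub>v v) $ i = (\<Sum>k = 0..<n. if k = i then d i * v $ i else 0)"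
      using that assms by (simp add: mat_diag_def scalar_prod_def if_distrib[of "\<lambda>x. x * _"] cong: if_cong)
    then show ?thesis using that by simp
  qed
  then show ?thesis
    using assms unfolding scalar_prod_def lessThan_atLeast0
    by (intro sum.cong) (auto simp: power2_eq_square mat_diag_def)
qed

text \<open>Diagonalising both \<open>A\<close> and its pullback along \<open>P\<close> writes one
  diagonal quadratic form as the other one evaluated at linear forms, to which
  \<open>card_pos_coeffs_le\<close> applies. With a rectangular \<open>P\<close> this also covers
  restriction to a subspace.\<close>

lemma num_eigenvalues_congruence_le:
  fixes A :: "real mat"
  assumes A: "A \<in> carrier_mat n n" and sym: "A\<^sup>T = A" and P: "P \<in> carrier_mat n m"
  shows "num_eigenvalues (\<lambda>x. x > 0) (P\<^sup>T * A * P) \<le> num_eigenvalues (\<lambda>x. x > 0) A"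
    and "num_eigenvalues (\<lambda>x. x < 0) (P\<^sup>T * A * P) \<le> num_eigenvalues (\<lambda>x. x < 0) A"
proof -
  let ?B = "P\<^sup>T * A * P"
  have B: "?B \<in> carrier_mat m m" using A P by simp
  obtain Q d where Q: "Q \<in> carrier_mat n n" "Q\<^sup>T * Q = 1\<^sub>m n" "A = Q * mat_diag n d * Q\<^sup>T"
    by (rule real_spectral_theorem[OF A sym])
  obtain U e where U: "U \<in> carrier_mat m m" "U\<^sup>T * U = 1\<^sub>m m" "?B = U * mat_diag m e * U\<^sup>T"
    by (rule real_spectral_theorem[OF B symmetric_mat_congruence[OF A sym P]])
  \<comment> \<open>The matrix \<open>P\<close> expressed in the orthonormal eigenbases of the
    pullback and of \<open>A\<close>.\<close>
  define R where "R = Q\<^sup>T * (P * U)"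
  have R: "R \<in> carrier_mat n m" using Q P U by (simp add: R_def)
  have RT: "R\<^sup>T = U\<^sup>T * (P\<^sup>T * Q)"
    using Q P U unfolding R_def
    by (simp add: transpose_mult[of _ n n _ m] transpose_mult[of _ n m _ m] assoc_mult_mat[of _ m m _ n _ n])
  have "mat_diag m e = (U\<^sup>T * U) * mat_diag m e * (U\<^sup>T * U)"
    unfolding U(2) by (simp add: left_mult_one_mat[OF mat_diag_dim] right_mult_one_mat[OF mat_diag_dim])
  also have "\<dots> = U\<^sup>T * (U * mat_diag m e * U\<^sup>T) * U"
    using U(1) by (simp add: assoc_mult_mat[of _ m m _ m _ m] mult_carrier_mat[of _ m m _ m])
  also have "\<dots> = U\<^sup>T * (P\<^sup>T * (Q * mat_diag n d * Q\<^sup>T) * P) * U"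
    unfolding U(3)[symmetric] Q(3)[symmetric] ..
  also have "\<dots> = R\<^sup>T * (mat_diag n d * R)"
    unfolding RT unfolding R_def using U(1) P Q(1)
    by (simp add: assoc_mult_mat[of _ m n _ n _ m] assoc_mult_mat[of _ m n _ n _ n]
        assoc_mult_mat[of _ n n _ n _ n] assoc_mult_mat[of _ n n _ n _ m]
        assoc_mult_mat[of _ m m _ n _ m] assoc_mult_mat[of _ m m _ m _ m]
        assoc_mult_mat[of _ m m _ n _ n] assoc_mult_mat[of _ n n _ m _ m]
        assoc_mult_mat[of _ m n _ m _ m] mult_carrier_mat[of _ n n _ n] mult_carrier_mat[of _ m m _ m]
        mult_carrier_mat[of _ n n _ m] mult_carrier_mat[of _ m n _ n] mult_carrier_mat[of _ m n _ m]
        mult_carrier_mat[of _ m m _ n] mult_carrier_mat[of _ n m _ m])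
  finally have D: "mat_diag m e = R\<^sup>T * (mat_diag n d * R)" .
  have eq: "(\<Sum>j<m. e j * (x j)\<^sup>2) = (\<Sum>i<n. d i * (\<Sum>j<m. R $$ (i, j) * x j)\<^sup>2)" for x
  proof -
    let ?v = "vec m x"
    have v: "?v \<in> carrier_vec m" by simp
    have Rv: "R *\<^sub>v ?v \<in> carrier_vec n" using R v by simp
    have DRv: "mat_diag n d *\<^sub>v (R *\<^sub>v ?v) \<in> carrier_vec n"
      by (rule mult_mat_vec_carrier[OF mat_diag_dim Rv])
    have "(\<Sum>j<m. e j * (x j)\<^sup>2) = ?v \<bullet> (mat_diag m e *\<^sub>v ?v)"
      by (simp add: scalar_prod_mat_diag[OF v])
    also have "mat_diag m e *\<^sub>v ?v = R\<^sup>T *\<^sub>v (mat_diag n d *\<^sub>v (R *\<^sub>v ?v))"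
      unfolding D using R v
      by (simp add: assoc_mult_mat_vec[of _ m n _ m] assoc_mult_mat_vec[of _ n n _ m]
          mult_carrier_mat[of _ n n _ m])
    also have "?v \<bullet> \<dots> = (R\<^sup>T *\<^sub>v (mat_diag n d *\<^sub>v (R *\<^sub>v ?v))) \<bullet> ?v"
      by (rule comm_scalar_prod[OF v mult_mat_vec_carrier[OF _ DRv]]) (use R in simp)
    also have "\<dots> = (mat_diag n d *\<^sub>v (R *\<^sub>v ?v)) \<bullet> (R *\<^sub>v ?v)"
      by (rule transpose_vec_mult_scalar[OF R v DRv])
    also have "\<dots> = (R *\<^sub>v ?v) \<bullet> (mat_diag n d *\<^sub>v (R *\<^sub>v ?v))"
      by (rule comm_scalar_prod[OF DRv Rv])
    also have "\<dots> = (\<Sum>i<n. d i * ((R *\<^sub>v ?v) $ i)\<^sup>2)"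
      by (rule scalar_prod_mat_diag[OF Rv])
    also have "\<dots> = (\<Sum>i<n. d i * (\<Sum>j<m. R $$ (i, j) * x j)\<^sup>2)"
      using R by (intro sum.cong refl) (auto simp: scalar_prod_def lessThan_atLeast0)
    finally show ?thesis .
  qed
  \<comment> \<open>Changing all signs turns the count of negative coefficients into one of positive
    coefficients.\<close>
  have neq: "(\<Sum>j<m. - e j * (x j)\<^sup>2) = (\<Sum>i<n. - d i * (\<Sum>j<m. R $$ (i, j) * x j)\<^sup>2)" for x
    using eq[of x] by (simp add: sum_negf)
  note ne = num_eigenvalues_orthogonal_diag[OF Q(1,2), of _ d, folded Q(3)]
    num_eigenvalues_orthogonal_diag[OF U(1,2), of _ e, folded U(3)]
  show "num_eigenvalues (\<lambda>x. x > 0) ?B \<le> num_eigenvalues (\<lambda>x. x > 0) A"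
    unfolding ne by (rule card_pos_coeffs_le[OF eq])
  show "num_eigenvalues (\<lambda>x. x < 0) ?B \<le> num_eigenvalues (\<lambda>x. x < 0) A"
    unfolding ne using card_pos_coeffs_le[OF neq] by simp
qed

lemma sylvester_law_of_inertia:
  fixes A :: "real mat"
  assumes A: "A \<in> carrier_mat n n" and sym: "A\<^sup>T = A"
    and P: "P \<in> carrier_mat n n" and P': "P' \<in> carrier_mat n n" and inv: "P * P' = 1\<^sub>m n"
  shows "inertia (P\<^sup>T * A * P) = inertia A"
proof -
  let ?B = "P\<^sup>T * A * P"
  have B: "?B \<in> carrier_mat n n" using A P by simp
  have symB: "?B\<^sup>T = ?B" by (rule symmetric_mat_congruence[OF A sym P])
  \<comment> \<open>Pulling back along the inverse recovers \<open>A\<close>, so the inequalities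
    for congruent matrices hold in both directions.\<close>
  have "P'\<^sup>T * ?B * P' = (P * P')\<^sup>T * A * (P * P')"
    using A P P' by (simp add: transpose_mult[of _ n n _ n] assoc_mult_mat[of _ n n _ n _ n])
  then have "P'\<^sup>T * ?B * P' = A"
    using A by (simp add: inv)
  then have "num_eigenvalues (\<lambda>x. x > 0) ?B = num_eigenvalues (\<lambda>x. x > 0) A"
    "num_eigenvalues (\<lambda>x. x < 0) ?B = num_eigenvalues (\<lambda>x. x < 0) A"
    using num_eigenvalues_congruence_le[OF A sym P] num_eigenvalues_congruence_le[OF B symB P']
    by auto
  then show ?thesis
    using num_eigenvalues_sum[OF A sym] num_eigenvalues_sum[OF B symB]
    by (simp add: inertia_def)
qed

section \<open>Inertia from definiteness and from test vectors\<close>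

lemma num_eigenvalues_neg_def:
  fixes A :: "real mat"
  assumes A: "A \<in> carrier_mat n n" and sym: "A\<^sup>T = A"
    and neg: "\<And>v. v \<in> carrier_vec n \<Longrightarrow> v \<noteq> 0\<^sub>v n \<Longrightarrow> v \<bullet> (A *\<^sub>v v) < 0"
  shows "num_eigenvalues (\<lambda>x. x < 0) A = n"
proof -
  obtain Q d where Q: "Q \<in> carrier_mat n n" "Q\<^sup>T * Q = 1\<^sub>m n" "A = Q * mat_diag n d * Q\<^sup>T"
    by (rule real_spectral_theorem[OF A sym])
  have "d i < 0" if i: "i < n" for i
  proof -
    let ?e = "unit_vec n i :: real vec"
    \<comment> \<open>The eigenvector for \<open>d i\<close>, that is column \<open>i\<close> of
      \<open>Q\<close>; the form takes the value \<open>d i\<close> there.\<close>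
    define v where "v = Q *\<^sub>v ?e"
    have v: "v \<in> carrier_vec n" using Q by (simp add: v_def)
    have QTv: "Q\<^sup>T *\<^sub>v v = ?e"
      unfolding v_def using Q(1,2) assoc_mult_mat_vec[of "Q\<^sup>T" n n Q n ?e] by simp
    have "v \<noteq> 0\<^sub>v n"
    proof
      assume "v = 0\<^sub>v n"
      then have "?e = Q\<^sup>T *\<^sub>v 0\<^sub>v n" using QTv by simp
      also have "\<dots> = 0\<^sub>v n" using Q(1) by (intro eq_vecI) (auto simp: scalar_prod_def)
      finally have "?e = 0\<^sub>v n" .
      then have "?e $ i = (0\<^sub>v n :: real vec) $ i" by (rule arg_cong)
      then show False using i by simp
    qed
    have "A *\<^sub>v v = Q *\<^sub>v (mat_diag n d *\<^sub>v ?e)"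
      unfolding Q(3) using Q(1) v mult_carrier_mat[OF Q(1) mat_diag_dim]
      by (simp add: assoc_mult_mat_vec[of _ n n _ n] QTv)
    then have "v \<bullet> (A *\<^sub>v v) = ?e \<bullet> (mat_diag n d *\<^sub>v ?e)"
      using transpose_vec_mult_scalar[OF Q(1) mult_mat_vec_carrier[OF mat_diag_dim] v, of ?e d] QTv
      by simp
    also have "\<dots> = (\<Sum>k<n. if k = i then d i else 0)"
      using i by (subst scalar_prod_mat_diag[of _ n]) (simp, intro sum.cong, auto)
    finally show ?thesis
      using neg[OF v \<open>v \<noteq> 0\<^sub>v n\<close>] i by simp
  qed
  then have "{i. i < n \<and> d i < 0} = {..<n}" by auto
  then show ?thesis
    unfolding Q(3) num_eigenvalues_orthogonal_diag[OF Q(1,2)] by simp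
qed

lemma inertia_neg_def:
  fixes A :: "real mat"
  assumes A: "A \<in> carrier_mat n n" and sym: "A\<^sup>T = A"
    and neg: "\<And>v. v \<in> carrier_vec n \<Longrightarrow> v \<noteq> 0\<^sub>v n \<Longrightarrow> v \<bullet> (A *\<^sub>v v) < 0"
  shows "inertia A = (0, n, 0)"
  using num_eigenvalues_neg_def[OF assms] num_eigenvalues_sum[OF A sym] by (simp add: inertia_def)

text \<open>The pullback along \<open>P\<close> is negative definite, hence has \<open>m\<close>
  negative eigenvalues, and a pullback never has more of them than \<open>A\<close>.\<close>

lemma num_neg_eigenvalues_ge:
  fixes A :: "real mat"
  assumes A: "A \<in> carrier_mat n n" and sym: "A\<^sup>T = A" and P: "P \<in> carrier_mat n m"
    and neg: "\<And>y. y \<in> carrier_vec m \<Longrightarrow> y \<noteq> 0\<^sub>v m \<Longrightarrow> (P *\<^sub>v y) \<bullet> (A *\<^sub>v (P *\<^sub>v y)) < 0"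
  shows "m \<le> num_eigenvalues (\<lambda>x. x < 0) A"
proof -
  let ?B = "P\<^sup>T * A * P"
  have B: "?B \<in> carrier_mat m m" using A P by simp
  have "num_eigenvalues (\<lambda>x. x < 0) ?B = m"
  proof (rule num_eigenvalues_neg_def[OF B symmetric_mat_congruence[OF A sym P]])
    fix y :: "real vec" assume y: "y \<in> carrier_vec m" "y \<noteq> 0\<^sub>v m"
    have Py: "P *\<^sub>v y \<in> carrier_vec n" using P y by simp
    have "?B *\<^sub>v y = P\<^sup>T *\<^sub>v (A *\<^sub>v (P *\<^sub>v y))"
      using A P y mult_carrier_mat[of "P\<^sup>T" m n A n]
      by (simp add: assoc_mult_mat_vec[of _ m n _ m] assoc_mult_mat_vec[of _ m n _ n] del: assoc_mult_mat)
    then have "y \<bullet> (?B *\<^sub>v y) = (P\<^sup>T *\<^sub>v (A *\<^sub>v (P *\<^sub>v y))) \<bullet> y"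
      using y A P by (simp add: comm_scalar_prod[of _ m])
    also have "\<dots> = (A *\<^sub>v (P *\<^sub>v y)) \<bullet> (P *\<^sub>v y)"
      using A Py by (intro transpose_vec_mult_scalar[OF P y(1)]) auto
    also have "\<dots> = (P *\<^sub>v y) \<bullet> (A *\<^sub>v (P *\<^sub>v y))"
      using A Py by (intro comm_scalar_prod[of _ n]) auto
    finally show "y \<bullet> (?B *\<^sub>v y) < 0" using neg[OF y] by simp
  qed
  then show ?thesis
    using num_eigenvalues_congruence_le(2)[OF A sym P] by simp
qed

text \<open>Restriction to the line through \<open>v\<close> forces a positive eigenvalue and
  restriction to the line through \<open>w\<close> a negative one; in dimension 2 this exhausts the
  spectrum.\<close>

lemma inertia_indefinite_2:
  fixes A :: "real mat"
  assumes A: "A \<in> carrier_mat 2 2" and sym: "A\<^sup>T = A"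
    and v: "v \<in> carrier_vec 2" "v \<bullet> (A *\<^sub>v v) > 0" and w: "w \<in> carrier_vec 2" "w \<bullet> (A *\<^sub>v w) < 0"
  shows "inertia A = (1, 1, 0)"
proof -
  have *: "(mat_of_cols 2 [u])\<^sup>T * A * mat_of_cols 2 [u] = mat_diag 1 (\<lambda>_. u \<bullet> (A *\<^sub>v u))"
    if u: "u \<in> carrier_vec 2" for u
  proof -
    have P: "mat_of_cols 2 [u] \<in> carrier_mat 2 1" by (simp add: mat_of_cols_def)
    have "(mat_of_cols 2 [u])\<^sup>T * A * mat_of_cols 2 [u] = (mat_of_cols 2 [u])\<^sup>T * (A * mat_of_cols 2 [u])"
      using P A by simp
    also have "\<dots> = mat_diag 1 (\<lambda>_. u \<bullet> (A *\<^sub>v u))"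
      using u A by (intro eq_matI)
        (auto simp: mat_diag_def scalar_prod_def mat_of_cols_def numeral_2_eq_2)
    finally show ?thesis .
  qed
  have P: "mat_of_cols 2 [u] \<in> carrier_mat 2 1" for u :: "real vec" by (simp add: mat_of_cols_def)
  have "1 \<le> num_eigenvalues (\<lambda>x. x > 0) A"
    using num_eigenvalues_congruence_le(1)[OF A sym P[of v]] v
    by (simp add: * num_eigenvalues_mat_diag)
  moreover have "1 \<le> num_eigenvalues (\<lambda>x. x < 0) A"
    using num_eigenvalues_congruence_le(2)[OF A sym P[of w]] w
    by (simp add: * num_eigenvalues_mat_diag)
  ultimately show ?thesis
    using num_eigenvalues_sum[OF A sym] by (simp add: inertia_def)
qed

lemma num_zero_eigenvalues_ge_1:
  fixes A :: "real mat"
  assumes A: "A \<in> carrier_mat n n" and v: "v \<in> carrier_vec n" "v \<noteq> 0\<^sub>v n" "A *\<^sub>v v = 0\<^sub>v n"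
  shows "1 \<le> num_eigenvalues (\<lambda>x. x = 0) A"
proof -
  have "0 \<cdot>\<^sub>v v = 0\<^sub>v n" using v(1) by (intro eq_vecI) auto
  then have "eigenvalue A 0"
    unfolding eigenvalue_def eigenvector_def using A v by auto
  then have "poly (char_poly A) 0 = 0"
    using eigenvalue_root_char_poly[OF A] by simp
  moreover have "char_poly A \<noteq> 0"
    using degree_monic_char_poly[OF A] by auto
  ultimately have "0 \<in> set_mset (filter_mset (\<lambda>x. x = 0) (proots (char_poly A)))"
    by simp
  then have "filter_mset (\<lambda>x. x = 0) (proots (char_poly A)) \<noteq> {#}"
    by force
  then have "0 < num_eigenvalues (\<lambda>x. x = 0) A"
    unfolding num_eigenvalues_def nonempty_has_size .
  then show ?thesis by simp
qed

section \<open>Block matrices and Schur complements\<close>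

text \<open>The characteristic polynomial is the product of those of the blocks, so the multisets of
  roots add.\<close>

lemma num_eigenvalues_block_diag:
  fixes A B :: "real mat"
  assumes A: "A \<in> carrier_mat m m" and B: "B \<in> carrier_mat n n"
  shows "num_eigenvalues P (four_block_mat A (0\<^sub>m m n) (0\<^sub>m n m) B)
    = num_eigenvalues P A + num_eigenvalues P B"
proof -
  let ?M = "four_block_mat A (0\<^sub>m m n) (0\<^sub>m n m) B"
  have "char_poly_matrix ?M
      = four_block_mat (char_poly_matrix A) (0\<^sub>m m n) (0\<^sub>m n m) (char_poly_matrix B)"
    using A B by (intro eq_matI) (auto simp: char_poly_matrix_def)
  then have "char_poly ?M = char_poly A * char_poly B"
    unfolding char_poly_def using A B by (simp add: det_four_block_mat_lower_left_zero[of _ m _ n])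
  moreover have "char_poly A \<noteq> 0" "char_poly B \<noteq> 0"
    using degree_monic_char_poly[OF A] degree_monic_char_poly[OF B] by auto
  ultimately show ?thesis
    by (simp add: num_eigenvalues_def proots_mult)
qed

text \<open>Block elimination is a congruence: the unipotent matrix with upper right block
  \<open>- (A' * B)\<close> clears both off-diagonal blocks, and Sylvester's law applies. Here
  \<open>A'\<close> is the inverse of \<open>A\<close>.\<close>

lemma inertia_schur_complement:
  fixes A B C :: "real mat"
  assumes A: "A \<in> carrier_mat m m" and symA: "A\<^sup>T = A" and A': "A' \<in> carrier_mat m m"
    and symA': "A'\<^sup>T = A'" and inv: "A * A' = 1\<^sub>m m" "A' * A = 1\<^sub>m m"
    and B: "B \<in> carrier_mat m n" and C: "C \<in> carrier_mat n n" and symC: "C\<^sup>T = C"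
  shows "inertia (four_block_mat A B B\<^sup>T C)
    = inertia (four_block_mat A (0\<^sub>m m n) (0\<^sub>m n m) (C - B\<^sup>T * (A' * B)))"
proof -
  let ?M = "four_block_mat A B B\<^sup>T C"
  have AB: "A' * B \<in> carrier_mat m n" using A' B by simp
  have BAB: "B\<^sup>T * (A' * B) \<in> carrier_mat n n" using AB B by simp
  define P where "P = four_block_mat (1\<^sub>m m) (- (A' * B)) (0\<^sub>m n m) (1\<^sub>m n)"
  define P' where "P' = four_block_mat (1\<^sub>m m) (A' * B) (0\<^sub>m n m) (1\<^sub>m n)"
  have P: "P \<in> carrier_mat (m + n) (m + n)" and P': "P' \<in> carrier_mat (m + n) (m + n)"
    by (simp_all add: P_def P'_def)
  have M: "?M \<in> carrier_mat (m + n) (m + n)" using A C by simp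
  have symM: "?M\<^sup>T = ?M"
    using A B C symA symC by (simp add: transpose_four_block_mat[of _ m m _ n _ n])
  have ABz: "A' * B + - (A' * B) = 0\<^sub>m m n"
    using carrier_matD[OF AB] by (intro eq_matI) (auto simp del: index_mult_mat(1))
  have "P * P' = 1\<^sub>m (m + n)"
    unfolding P_def P'_def
    using AB left_mult_one_mat[OF AB] right_mult_one_mat[OF uminus_carrier_mat[OF AB]]
    by (subst mult_four_block_mat[of _ m m _ n _ n _ _ m _ n])
      (auto simp: ABz left_mult_zero_mat[of _ m] right_mult_zero_mat[of _ m] simp flip: four_block_one_mat)
  then have "inertia (P\<^sup>T * ?M * P) = inertia ?M"
    by (rule sylvester_law_of_inertia[OF M symM P P'])
  moreover have "P\<^sup>T * ?M * P = four_block_mat A (0\<^sub>m m n) (0\<^sub>m n m) (C - B\<^sup>T * (A' * B))"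
  proof -
    have PT: "P\<^sup>T = four_block_mat (1\<^sub>m m) (0\<^sub>m m n) (- (B\<^sup>T * A')) (1\<^sub>m n)"
      unfolding P_def using AB A' B symA'
      by (simp add: transpose_four_block_mat[of _ m m _ n _ n] transpose_uminus transpose_mult[of _ m m _ n])
    have 1: "A * (A' * B) = B"
      using A A' B inv by (simp flip: assoc_mult_mat[of _ m m _ m _ n])
    have 2: "B\<^sup>T * A' * A = B\<^sup>T"
      using A A' B inv by (simp add: assoc_mult_mat[of _ n m _ m _ m])
    have BTA: "B\<^sup>T * A' \<in> carrier_mat n m" using A' B by simp
    have 3: "A * - (A' * B) = - B"
      using A A' B 1 by simp
    have 4: "B\<^sup>T * - (A' * B) = - (B\<^sup>T * (A' * B))"
      using B A' by simp
    have 5: "- (B\<^sup>T * A') * A = - B\<^sup>T"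
      using B A' A 2 by simp
    have "?M * P = four_block_mat (A * 1\<^sub>m m + B * 0\<^sub>m n m) (A * - (A' * B) + B * 1\<^sub>m n)
        (B\<^sup>T * 1\<^sub>m m + C * 0\<^sub>m n m) (B\<^sup>T * - (A' * B) + C * 1\<^sub>m n)"
      unfolding P_def using A B C AB by (intro mult_four_block_mat[of _ m m _ n _ n _ _ m _ n]) auto
    \<comment> \<open>Multiplication by \<open>P\<close> on the right clears the upper right block;
      the transpose of \<open>P\<close> on the left then clears the lower left one.\<close>
    also have "\<dots> = four_block_mat A (0\<^sub>m m n) B\<^sup>T (C - B\<^sup>T * (A' * B))"
    proof (rule cong_four_block_mat)
      show "A * 1\<^sub>m m + B * 0\<^sub>m n m = A" "B\<^sup>T * 1\<^sub>m m + C * 0\<^sub>m n m = B\<^sup>T"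
        using A B C by (simp_all add: right_mult_zero_mat)
      show "A * - (A' * B) + B * 1\<^sub>m n = 0\<^sub>m m n"
        unfolding 3 using B by (intro eq_matI) auto
      show "B\<^sup>T * - (A' * B) + C * 1\<^sub>m n = C - B\<^sup>T * (A' * B)"
        unfolding 4 right_mult_one_mat[OF C] using carrier_matD[OF BAB] carrier_matD[OF C]
        by (intro eq_matI) (auto simp del: index_mult_mat(1))
    qed
    finally have MP: "?M * P = four_block_mat A (0\<^sub>m m n) B\<^sup>T (C - B\<^sup>T * (A' * B))" .
    have S: "C - B\<^sup>T * (A' * B) \<in> carrier_mat n n" by (rule minus_carrier_mat[OF BAB])
    have BT: "B\<^sup>T \<in> carrier_mat n m" using B by simp
    have "P\<^sup>T * (?M * P) = four_block_mat (1\<^sub>m m * A + 0\<^sub>m m n * B\<^sup>T)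
        (1\<^sub>m m * 0\<^sub>m m n + 0\<^sub>m m n * (C - B\<^sup>T * (A' * B)))
        (- (B\<^sup>T * A') * A + 1\<^sub>m n * B\<^sup>T)
        (- (B\<^sup>T * A') * 0\<^sub>m m n + 1\<^sub>m n * (C - B\<^sup>T * (A' * B)))"
      unfolding PT MP 
      by (rule mult_four_block_mat[OF one_carrier_mat zero_carrier_mat uminus_carrier_mat[OF BTA]
            one_carrier_mat A zero_carrier_mat BT S])
    also have "\<dots> = four_block_mat A (0\<^sub>m m n) (0\<^sub>m n m) (C - B\<^sup>T * (A' * B))"
    proof (rule cong_four_block_mat)
      show "1\<^sub>m m * A + 0\<^sub>m m n * B\<^sup>T = A"
        using A by (simp add: left_mult_zero_mat[OF BT])
      show "1\<^sub>m m * 0\<^sub>m m n + 0\<^sub>m m n * (C - B\<^sup>T * (A' * B)) = 0\<^sub>m m n"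
        by (simp add: left_mult_zero_mat[OF S])
      show "- (B\<^sup>T * A') * A + 1\<^sub>m n * B\<^sup>T = 0\<^sub>m n m"
        unfolding 5 using B by (intro eq_matI) auto
      show "- (B\<^sup>T * A') * 0\<^sub>m m n + 1\<^sub>m n * (C - B\<^sup>T * (A' * B)) = C - B\<^sup>T * (A' * B)"
        using right_mult_zero_mat[OF uminus_carrier_mat[OF BTA], of n] S
        by (simp add: left_mult_one_mat[OF S])
    qed
    finally have "P\<^sup>T * (?M * P) = four_block_mat A (0\<^sub>m m n) (0\<^sub>m n m) (C - B\<^sup>T * (A' * B))" .
    then show ?thesis
      using P M by (simp add: assoc_mult_mat[of _ "m + n" "m + n" _ "m + n" _ "m + n"])
  qed
  ultimately show ?thesis by simp
qed

section \<open>Cycles with a signed closing edge\<close>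

text \<open>
  For a single vertex both corner terms fall on the only entry, which becomes \<open>w + 2 s\<close>; for two
  vertices the off-diagonal entries become \<open>1 + s\<close>. With \<open>s = 1\<close> these are the conventions for
  short cycles.
\<close>

definition cyc_form :: "real \<Rightarrow> int list \<Rightarrow> real mat" where
  "cyc_form s ws = (let n = length ws in mat n n (\<lambda>(i, j).
     (if i = j then real_of_int (ws ! i) else 0) + of_bool (j = Suc i) + of_bool (i = Suc j)
     + s * (of_bool (Suc i = n \<and> j = 0) + of_bool (i = 0 \<and> Suc j = n))))"

lemma cyc_form_carrier [simp]: "cyc_form s ws \<in> carrier_mat (length ws) (length ws)"
  by (simp add: cyc_form_def Let_def)

lemma transpose_cyc_form [simp]: "(cyc_form s ws)\<^sup>T = cyc_form s ws"
  by (rule eq_matI) (auto simp: cyc_form_def Let_def)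

text \<open>Only the edges \<open>i\<close> and \<open>j\<close> can join the two vertices: the
  former if \<open>j\<close> is the cyclic successor of \<open>i\<close>, the latter if
  \<open>i\<close> is that of \<open>j\<close>. For \<open>m = 2\<close> both happen. The corner
  terms record the successor that wraps around.\<close>

lemma num_edges_eq:
  assumes "2 \<le> m" "i < m" "j < m" "i \<noteq> j"
  shows "num_edges m i j = of_bool (j = Suc i) + of_bool (i = Suc j)
    + (of_bool (Suc i = m \<and> j = 0) + of_bool (i = 0 \<and> Suc j = m))"
proof -
  have "{e. e < m \<and> {e, Suc e mod m} = {i, j}}
      = (if j = Suc i mod m then {i} else {}) \<union> (if i = Suc j mod m then {j} else {})"
    using assms by (auto simp: doubleton_eq_iff)
  moreover have "card ((if j = Suc i mod m then {i} else {}) \<union> (if i = Suc j mod m then {j} else {}))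
      = of_bool (j = Suc i mod m) + of_bool (i = Suc j mod m)"
    using assms by (subst card_Un_disjoint) auto
  moreover have "Suc k mod m = (if Suc k = m then 0 else Suc k)" if "k < m" for k
    using that by (auto simp: mod_Suc)
  ultimately show ?thesis
    using assms unfolding num_edges_def by auto
qed

lemma circ_form_eq_cyc_form:
  assumes "ws \<noteq> []"
  shows "map_mat real_of_int (circ_form ws) = cyc_form 1 ws"
proof (rule eq_matI)
  fix i j assume "i < dim_row (cyc_form 1 ws)" "j < dim_col (cyc_form 1 ws)"
  then have ij: "i < length ws" "j < length ws"
    using carrier_matD[OF cyc_form_carrier[of 1 ws]] by auto
  show "map_mat real_of_int (circ_form ws) $$ (i, j) = cyc_form 1 ws $$ (i, j)"
  proof (cases "i = j")
    case True
    then show ?thesis using ij assms by (auto simp: circ_form_def cyc_form_def Let_def)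
  next
    case False
    then have "2 \<le> length ws" using ij by auto
    then show ?thesis
      using ij False num_edges_eq[OF _ ij False] by (simp add: circ_form_def cyc_form_def Let_def)
  qed
qed (auto simp: circ_form_def cyc_form_def Let_def)

lemma circ_inertia_eq: "ws \<noteq> [] \<Longrightarrow> circ_inertia ws = inertia (cyc_form 1 ws)"
  by (simp add: circ_inertia_def circ_form_eq_cyc_form)

text \<open>The form takes the values 2 and -2 at (1, 1) and (1, -1).\<close>

lemma inertia_hyperbolic_plane: "inertia (mat 2 2 (\<lambda>(i, j). of_bool (i \<noteq> j))) = (1, 1, 0)"
  by (rule inertia_indefinite_2[of _ "vec 2 (\<lambda>_. 1)" "vec 2 (\<lambda>i. if i = 0 then 1 else - 1)"])
    (auto simp: scalar_prod_def numeral_2_eq_2 intro!: eq_matI)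

text \<open>The block of the two zero vertices is the hyperbolic plane, which is its own inverse.
  Its Schur complement is the cycle on \<open>ws\<close> with closing sign
  \<open>- s\<close>.\<close>

lemma inertia_cyc_form_two_zeros:
  assumes ws: "ws \<noteq> []" and s: "inertia (cyc_form (- s) ws) = (p, q, z)"
  shows "inertia (cyc_form s (0 # 0 # ws)) = (Suc p, Suc q, z)"
proof -
  define n where "n = length ws"
  have n: "0 < n" using ws by (simp add: n_def)
  define H :: "real mat" where "H = mat 2 2 (\<lambda>(i, j). of_bool (i \<noteq> j))"
  \<comment> \<open>The first zero vertex meets the last vertex of \<open>ws\<close> through the
    closing edge, the second one meets the first vertex of \<open>ws\<close> through an ordinary
    edge. The block \<open>C\<close> below is the path on \<open>ws\<close>.\<close>
  define B where "B = mat 2 n (\<lambda>(i, j). if i = 0 then s * of_bool (Suc j = n) else of_bool (j = 0))"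
  define C where "C = mat n n (\<lambda>(i, j). (if i = j then real_of_int (ws ! i) else 0)
      + of_bool (j = Suc i) + of_bool (i = Suc j))"
  have H: "H \<in> carrier_mat 2 2" "H\<^sup>T = H" "H * H = 1\<^sub>m 2"
    by (auto simp: H_def scalar_prod_def numeral_2_eq_2 less_Suc_eq intro!: eq_matI)
  have B: "B \<in> carrier_mat 2 n" by (simp add: B_def)
  have C: "C \<in> carrier_mat n n" "C\<^sup>T = C" by (auto simp: C_def intro!: eq_matI)
  have split: "cyc_form s (0 # 0 # ws) = four_block_mat H B B\<^sup>T C"
  proof (rule eq_matI)
    fix i j
    assume "i < dim_row (four_block_mat H B B\<^sup>T C)" "j < dim_col (four_block_mat H B B\<^sup>T C)"
    then have ij: "i < n + 2" "j < n + 2" using carrier_matD[OF H(1)] carrier_matD[OF C(1)] by auto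
    have nat_cases: "k = 0 \<or> k = 1 \<or> (\<exists>k'. k = Suc (Suc k'))" for k :: nat by presburger
    show "cyc_form s (0 # 0 # ws) $$ (i, j) = four_block_mat H B B\<^sup>T C $$ (i, j)"
      using nat_cases[of i] nat_cases[of j] n ij
      by (elim disjE exE; simp add: cyc_form_def Let_def H_def B_def C_def n_def[symmetric])
  qed (use n in \<open>auto simp: cyc_form_def Let_def H_def C_def n_def\<close>)
  \<comment> \<open>Multiplication by \<open>H\<close> swaps the rows of \<open>B\<close>, so the
    transpose of \<open>B\<close> times \<open>H * B\<close> is supported on the two corners, each
    with value \<open>s\<close>. For a single remaining vertex the corners coincide and add up to
    \<open>2 * s\<close>.\<close>
  have HB: "H * B = mat 2 n (\<lambda>(i, j). if i = 0 then of_bool (j = 0) else s * of_bool (Suc j = n))"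
    by (rule eq_matI) (auto simp: H_def B_def scalar_prod_def numeral_2_eq_2 less_Suc_eq)
  have "C - B\<^sup>T * (H * B) = cyc_form (- s) ws"
    unfolding HB
    by (rule eq_matI) (auto simp: C_def B_def cyc_form_def Let_def scalar_prod_def
        n_def[symmetric] numeral_2_eq_2 algebra_simps)
  then have "inertia (cyc_form s (0 # 0 # ws))
      = inertia (four_block_mat H (0\<^sub>m 2 n) (0\<^sub>m n 2) (cyc_form (- s) ws))"
    unfolding split by (subst inertia_schur_complement[OF H(1,2) H(1,2) H(3) H(3) B C]) simp
  then show ?thesis
    using s inertia_hyperbolic_plane[folded H_def] cyc_form_carrier[of "- s" ws]
      num_eigenvalues_block_diag[OF H(1), of "cyc_form (- s) ws" n]
    by (simp add: inertia_def n_def)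
qed

text \<open>The induction runs over all signs \<open>s\<close>, since each removed pair of zeros
  flips the sign.\<close>

lemma inertia_cyc_form_even_zeros:
  assumes "ws \<noteq> []" and "inertia (cyc_form (s * (- 1) ^ k) ws) = (p, q, z)"
  shows "inertia (cyc_form s (zeros (2 * k) @ ws)) = (k + p, k + q, z)"
  using assms(2)
proof (induction k arbitrary: s)
  case (Suc k)
  have "inertia (cyc_form (- s) (zeros (2 * k) @ ws)) = (k + p, k + q, z)"
    by (rule Suc.IH) (use Suc.prems in simp)
  then show ?case
    using inertia_cyc_form_two_zeros[of "zeros (2 * k) @ ws" s] assms(1) by simp
qed simp

lemma circ_inertia_even_zeros:
  assumes "ws \<noteq> []" and "inertia (cyc_form ((- 1) ^ k) ws) = (p, q, z)"
  shows "circ_inertia (zeros (2 * k) @ ws) = (k + p, k + q, z)"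
  using inertia_cyc_form_even_zeros[of ws 1 k p q z] assms by (simp add: circ_inertia_eq)

section \<open>Cycles without zero weights and short cycles\<close>

text \<open>Contribution of the path edges to the quadratic form; the last vertex has no successor
  along the path.\<close>

lemma sum_superdiagonal:
  fixes x y :: "nat \<Rightarrow> real"
  shows "(\<Sum>i<Suc m. \<Sum>j<Suc m. x i * of_bool (j = Suc i) * y j) = (\<Sum>i<m. x i * y (Suc i))"
proof -
  have "(\<Sum>j<Suc m. x i * of_bool (j = Suc i) * y j) = (if i < m then x i * y (Suc i) else 0)" for i
  proof -
    have "(\<Sum>j<Suc m. x i * of_bool (j = Suc i) * y j)
        = (\<Sum>j<Suc m. if j = Suc i then x i * y (Suc i) else 0)"
      by (rule sum.cong) auto
    then show ?thesis by (simp only: sum.delta) auto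
  qed
  then show ?thesis by simp
qed

lemma sum_corner:
  fixes x y :: "nat \<Rightarrow> real"
  shows "(\<Sum>i<Suc m. \<Sum>j<Suc m. x i * of_bool (i = m \<and> j = 0) * y j) = x m * y 0"
proof -
  have "(\<Sum>j<Suc m. x i * of_bool (i = m \<and> j = 0) * y j) = (if i = m then x m * y 0 else 0)" for i
    by (simp add: sum.lessThan_Suc_shift del: sum.lessThan_Suc)
  then show ?thesis by simp
qed

text \<open>Completing squares: twice a product of neighbouring coordinates is the sum of their
  squares minus the square of their difference. Every vertex is an endpoint twice, which raises its
  weight by 2. For the closing edge, \<open>s\<close> has square 1.\<close>

lemma cyc_form_quadratic_form:
  assumes n: "length ws = Suc m" and v: "v \<in> carrier_vec (Suc m)" and s: "s\<^sup>2 = 1"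
  shows "v \<bullet> (cyc_form s ws *\<^sub>v v) = (\<Sum>i<Suc m. (real_of_int (ws ! i) + 2) * (v $ i)\<^sup>2)
    - (\<Sum>i<m. (v $ i - v $ Suc i)\<^sup>2) - (v $ m - s * v $ 0)\<^sup>2"
proof -
  define x where "x i = v $ i" for i
  define c where "c i j = (if i = j then real_of_int (ws ! i) else 0) + of_bool (j = Suc i)
    + of_bool (i = Suc j) + s * (of_bool (i = m \<and> j = 0) + of_bool (j = m \<and> i = 0))" for i j
  have "v \<bullet> (cyc_form s ws *\<^sub>v v) = (\<Sum>i<Suc m. \<Sum>j<Suc m. x i * c i j * x j)"
    using v n by (simp add: cyc_form_def Let_def scalar_prod_def lessThan_atLeast0 x_def c_def
        sum_distrib_left mult.assoc conj_commute del: sum.op_ivl_Suc sum.lessThan_Suc)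
  also have "\<dots> = (\<Sum>i<Suc m. \<Sum>j<Suc m. if i = j then real_of_int (ws ! i) * (x i)\<^sup>2 else 0)
      + (\<Sum>i<Suc m. \<Sum>j<Suc m. x i * of_bool (j = Suc i) * x j)
      + (\<Sum>i<Suc m. \<Sum>j<Suc m. x j * of_bool (i = Suc j) * x i)
      + s * (\<Sum>i<Suc m. \<Sum>j<Suc m. x i * of_bool (i = m \<and> j = 0) * x j)
      + s * (\<Sum>i<Suc m. \<Sum>j<Suc m. x j * of_bool (j = m \<and> i = 0) * x i)"
    unfolding sum_distrib_left sum.distrib[symmetric]
    by (intro sum.cong refl) (auto simp: c_def algebra_simps power2_eq_square)
  \<comment> \<open>Exchanging the summations turns the subdiagonal into the superdiagonal, and
    below likewise one corner into the other.\<close>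
  also have "(\<Sum>i<Suc m. \<Sum>j<Suc m. x j * of_bool (i = Suc j) * x i) = (\<Sum>i<m. x i * x (Suc i))"
    by (subst sum.swap) (rule sum_superdiagonal)
  also have "(\<Sum>i<Suc m. \<Sum>j<Suc m. x j * of_bool (j = m \<and> i = 0) * x i) = x m * x 0"
    by (subst sum.swap) (rule sum_corner)
  also have "(\<Sum>i<Suc m. \<Sum>j<Suc m. if i = j then real_of_int (ws ! i) * (x i)\<^sup>2 else 0)
      = (\<Sum>i<Suc m. real_of_int (ws ! i) * (x i)\<^sup>2)"
    by (intro sum.cong refl) (simp only: sum.delta' finite_lessThan if_True)
  finally have lhs: "v \<bullet> (cyc_form s ws *\<^sub>v v) = (\<Sum>i<Suc m. real_of_int (ws ! i) * (x i)\<^sup>2)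
      + 2 * (\<Sum>i<m. x i * x (Suc i)) + 2 * s * x m * x 0"
    unfolding sum_superdiagonal sum_corner by simp
  have "(\<Sum>i<m. (x i - x (Suc i))\<^sup>2)
      = (\<Sum>i<m. (x i)\<^sup>2) + (\<Sum>i<m. (x (Suc i))\<^sup>2) - 2 * (\<Sum>i<m. x i * x (Suc i))"
    unfolding sum_distrib_left sum.distrib[symmetric] sum_subtractf[symmetric]
    by (intro sum.cong refl) (simp add: power2_eq_square algebra_simps)
  \<comment> \<open>The path edges miss one square of the last coordinate and one of the first; the
    closing edge supplies both.\<close>
  moreover have "(\<Sum>i<m. (x i)\<^sup>2) = (\<Sum>i<Suc m. (x i)\<^sup>2) - (x m)\<^sup>2" by simp
  moreover have "(\<Sum>i<m. (x (Suc i))\<^sup>2) = (\<Sum>i<Suc m. (x i)\<^sup>2) - (x 0)\<^sup>2"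
    unfolding sum.lessThan_Suc_shift by simp
  moreover have "(x m - s * x 0)\<^sup>2 = (x m)\<^sup>2 + (x 0)\<^sup>2 - 2 * s * x m * x 0"
    using s by (simp add: power2_diff power_mult_distrib)
  moreover have "(\<Sum>i<Suc m. (real_of_int (ws ! i) + 2) * (x i)\<^sup>2)
      = (\<Sum>i<Suc m. real_of_int (ws ! i) * (x i)\<^sup>2) + 2 * (\<Sum>i<Suc m. (x i)\<^sup>2)"
    unfolding sum_distrib_left sum.distrib[symmetric]
    by (intro sum.cong refl) (simp add: algebra_simps)
  ultimately show ?thesis
    using lhs unfolding x_def by linarith
qed

text \<open>With all weights at most -2, minus the form is a sum of nonnegative terms. Where the
  form is nonnegative, each of these terms vanishes.\<close>

lemma cyc_form_nonneg_vector:
  assumes n: "length ws = Suc m" and ws: "\<forall>w\<in>set ws. w \<le> - 2"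
    and v: "v \<in> carrier_vec (Suc m)" and s: "s\<^sup>2 = 1" and ge: "0 \<le> v \<bullet> (cyc_form s ws *\<^sub>v v)"
  shows "i \<le> m \<Longrightarrow> v $ i = v $ 0" and "v $ 0 = s * v $ 0"
    and "i \<le> m \<Longrightarrow> ws ! i < - 2 \<Longrightarrow> v $ i = 0"
proof -
  let ?a = "\<Sum>i<Suc m. - ((real_of_int (ws ! i) + 2) * (v $ i)\<^sup>2)"
  let ?b = "\<Sum>i<m. (v $ i - v $ Suc i)\<^sup>2"
  have a_nonneg: "0 \<le> - ((real_of_int (ws ! i) + 2) * (v $ i)\<^sup>2)" if "i < Suc m" for i
  proof -
    have "ws ! i \<le> - 2" using ws n that by simp
    then have "real_of_int (ws ! i) + 2 \<le> 0" by linarith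
    then show ?thesis by (simp add: mult_nonpos_nonneg)
  qed
  have "?a + ?b + (v $ m - s * v $ 0)\<^sup>2 \<le> 0"
    using ge unfolding cyc_form_quadratic_form[OF n v s] by (simp only: sum_negf)
  moreover have "0 \<le> ?a" by (rule sum_nonneg) (use a_nonneg in simp)
  moreover have "0 \<le> ?b" by (rule sum_nonneg) simp
  moreover have "0 \<le> (v $ m - s * v $ 0)\<^sup>2" by simp
  ultimately have a0: "?a = 0" and b0: "?b = 0" and c0: "(v $ m - s * v $ 0)\<^sup>2 = 0" by linarith+
  have step: "v $ i = v $ Suc i" if "i < m" for i
    using b0 that by (subst (asm) sum_nonneg_eq_0_iff) auto
  show const: "v $ i = v $ 0" if "i \<le> m" for i
    using that by (induction i) (auto simp flip: step)
  show "v $ 0 = s * v $ 0" using c0 const[of m] by simp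
  show "v $ i = 0" if "i \<le> m" "ws ! i < - 2"
  proof -
    have "- ((real_of_int (ws ! i) + 2) * (v $ i)\<^sup>2) = 0"
      using a0 a_nonneg that(1) by (subst (asm) sum_nonneg_eq_0_iff) auto
    then show ?thesis using that(2) by auto
  qed
qed

text \<open>A vector with nonnegative value is constant. Its first entry vanishes because it equals
  its own negative if \<open>s = - 1\<close>, and because of a weight below -2 otherwise.\<close>

lemma inertia_cyc_form_neg_def:
  assumes "ws \<noteq> []" and ws: "\<forall>w\<in>set ws. w \<le> - 2" and s: "s = - 1 \<or> s = 1 \<and> (\<exists>w\<in>set ws. w < - 2)"
  shows "inertia (cyc_form s ws) = (0, length ws, 0)"
proof (rule inertia_neg_def)
  obtain m where n: "length ws = Suc m" using assms(1) by (cases ws) auto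
  have s2: "s\<^sup>2 = 1" using s by auto
  fix v :: "real vec" assume v: "v \<in> carrier_vec (length ws)" "v \<noteq> 0\<^sub>v (length ws)"
  show "v \<bullet> (cyc_form s ws *\<^sub>v v) < 0"
  proof (rule ccontr)
    assume "\<not> ?thesis"
    then have ge: "0 \<le> v \<bullet> (cyc_form s ws *\<^sub>v v)" by simp
    note * = cyc_form_nonneg_vector[OF n ws v(1)[unfolded n] s2 ge]
    have "v $ 0 = 0"
      using s
    proof
      assume "s = - 1"
      then show ?thesis using *(2) by simp
    next
      assume "s = 1 \<and> (\<exists>w\<in>set ws. w < - 2)"
      then obtain i where i: "i < Suc m" "ws ! i < - 2" by (auto simp: in_set_conv_nth n)
      then show ?thesis using *(1)[of i] *(3)[of i] by simp
    qed
    then have "v = 0\<^sub>v (length ws)"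
      using v(1) n by (intro eq_vecI) (simp_all add: *(1)[unfolded \<open>v $ 0 = 0\<close>])
    then show False using v by simp
  qed
qed simp_all

text \<open>The form is negative definite on the vectors with last coordinate 0, which gives
  \<open>n - 1\<close> negative eigenvalues, and the all-ones vector lies in its kernel. Together
  these account for all \<open>n\<close> eigenvalues.\<close>

lemma inertia_cyc_form_minus_twos:
  assumes "0 < n"
  shows "inertia (cyc_form 1 (replicate n (- 2))) = (0, n - 1, 1)"
proof -
  obtain m where m: "n = Suc m" using assms by (cases n) auto
  let ?ws = "replicate n (- 2) :: int list"
  define A where "A = cyc_form 1 ?ws"
  have len: "length ?ws = Suc m" by (simp add: m)
  have A: "A \<in> carrier_mat (Suc m) (Suc m)" "A\<^sup>T = A"
    using cyc_form_carrier[of 1 ?ws] by (simp_all add: A_def m)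
  \<comment> \<open>The inclusion of the coordinate hyperplane where the last coordinate is
    0.\<close>
  let ?P = "mat (Suc m) m (\<lambda>(i, j). of_bool (i = j)) :: real mat"
  have P: "?P \<in> carrier_mat (Suc m) m" by simp
  have "m \<le> num_eigenvalues (\<lambda>x. x < 0) A"
  proof (rule num_neg_eigenvalues_ge[OF A P])
    fix y :: "real vec" assume y: "y \<in> carrier_vec m" "y \<noteq> 0\<^sub>v m"
    have Py: "?P *\<^sub>v y \<in> carrier_vec (Suc m)" by (rule mult_mat_vec_carrier[OF P y(1)])
    have idx: "(?P *\<^sub>v y) $ i = (if i < m then y $ i else 0)" if "i \<le> m" for i
    proof -
      have "(?P *\<^sub>v y) $ i = (\<Sum>j = 0..<m. if j = i then y $ i else 0)"
        using that y by (auto simp: scalar_prod_def intro!: sum.cong)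
      then show ?thesis by simp
    qed
    show "(?P *\<^sub>v y) \<bullet> (A *\<^sub>v (?P *\<^sub>v y)) < 0"
    proof (rule ccontr)
      assume "\<not> ?thesis"
      then have ge: "0 \<le> (?P *\<^sub>v y) \<bullet> (cyc_form 1 ?ws *\<^sub>v (?P *\<^sub>v y))"
        by (simp add: A_def)
      have const: "(?P *\<^sub>v y) $ i = (?P *\<^sub>v y) $ 0" if "i \<le> m" for i
        by (rule cyc_form_nonneg_vector(1)[OF len _ Py _ ge that]) auto
      \<comment> \<open>The constant value is that of coordinate \<open>m\<close>, which is
        0.\<close>
      have "y $ i = 0" if "i < m" for i
        using const[of i] const[of m] idx[of i] idx[of m] that by simp
      then have "y = 0\<^sub>v m" using y(1) by (intro eq_vecI) auto
      then show False using y(2) by simp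
    qed
  qed
  moreover have "1 \<le> num_eigenvalues (\<lambda>x. x = 0) A"
  proof (rule num_zero_eigenvalues_ge_1[OF A(1)])
    let ?u = "vec (Suc m) (\<lambda>_. 1) :: real vec"
    show "?u \<in> carrier_vec (Suc m)" by simp
    show "?u \<noteq> 0\<^sub>v (Suc m)"
    proof
      assume "?u = 0\<^sub>v (Suc m)"
      then have "?u $ 0 = (0\<^sub>v (Suc m) :: real vec) $ 0" by (rule arg_cong)
      then show False by simp
    qed
    show "A *\<^sub>v ?u = 0\<^sub>v (Suc m)"
    proof (rule eq_vecI)
      fix i assume "i < dim_vec (0\<^sub>v (Suc m) :: real vec)"
      then have i: "i \<le> m" by simp
      \<comment> \<open>A row sum: the weight -2 and two edge ends, each of which either stays on
        the path or belongs to the closing edge.\<close>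
      have "(A *\<^sub>v ?u) $ i = (\<Sum>j<Suc m. (if j = i then - 2 else 0) + (if j = Suc i then 1 else 0)
          + (if Suc j = i then 1 else 0) + (if j = 0 \<and> i = m then 1 else 0) + (if j = m \<and> i = 0 then 1 else 0))"
        using i by (simp add: A_def m cyc_form_def Let_def scalar_prod_def lessThan_atLeast0
            del: sum.op_ivl_Suc sum.lessThan_Suc replicate_Suc)
          (rule sum.cong, auto simp del: replicate_Suc)
      also have "\<dots> = - 2 + (if i < m then 1 else 0) + (if 0 < i then 1 else 0)
          + (if i = m then 1 else 0) + (if i = 0 then 1 else 0)"
      proof -
        have "(\<Sum>j<Suc m. if Suc j = i then 1 else 0 :: real) = (if 0 < i then 1 else 0)"
          using i by (cases i) (simp_all only: nat.inject sum.delta, auto)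
        moreover have "(\<Sum>j<Suc m. if j = 0 \<and> i = m then 1 else 0 :: real) = (if i = m then 1 else 0)"
          by (cases "i = m") (simp_all only: simp_thms sum.delta, auto)
        moreover have "(\<Sum>j<Suc m. if j = m \<and> i = 0 then 1 else 0 :: real) = (if i = 0 then 1 else 0)"
          by (cases "i = 0") (simp_all only: simp_thms sum.delta, auto)
        moreover have "(\<Sum>j<Suc m. if j = i then - 2 else 0 :: real) = - 2"
          by (subst sum.delta) (use i in auto)
        moreover have "(\<Sum>j<Suc m. if j = Suc i then 1 else 0 :: real) = (if i < m then 1 else 0)"
          by (subst sum.delta) auto
        ultimately show ?thesis by (simp only: sum.distrib)
      qed
      also have "\<dots> = 0" using i by auto
      finally show "(A *\<^sub>v ?u) $ i = 0\<^sub>v (Suc m) $ i" using i by simp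
    qed (use A in simp)
  qed
  ultimately show ?thesis
    using num_eigenvalues_sum[OF A] unfolding A_def[symmetric] by (simp add: inertia_def m)
qed

section \<open>Cycles with one or two vertices\<close>

lemma inertia_mat_diag:
  "inertia (mat_diag n d) = (card {i. i < n \<and> d i > 0}, card {i. i < n \<and> d i < 0}, card {i. i < n \<and> d i = 0})"
  by (simp add: inertia_def num_eigenvalues_mat_diag)

lemma inertia_cyc_form_singleton:
  "inertia (cyc_form s [w]) = (of_bool (w + 2 * s > 0), of_bool (w + 2 * s < 0), of_bool (w + 2 * s = 0))"
proof -
  have "cyc_form s [w] = mat_diag 1 (\<lambda>_. w + 2 * s)"
    by (rule eq_matI) (auto simp: cyc_form_def mat_diag_def)
  then show ?thesis by (auto simp: inertia_mat_diag)
qed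

lemma cyc_form_pair:
  "cyc_form s [a, b] = mat 2 2 (\<lambda>(i, j). if i = j then real_of_int (if i = 0 then a else b) else 1 + s)"
proof (rule eq_matI)
  let ?M = "mat 2 2 (\<lambda>(i, j). if i = j then real_of_int (if i = 0 then a else b) else 1 + s)"
  fix i j assume "i < dim_row ?M" "j < dim_col ?M"
  then have "i = 0 \<or> i = 1" "j = 0 \<or> j = 1" by auto
  then show "cyc_form s [a, b] $$ (i, j) = ?M $$ (i, j)"
    by (elim disjE) (simp_all add: cyc_form_def)
qed (simp_all add: cyc_form_def)

text \<open>The two edges have opposite signs and cancel, so the matrix is diagonal.\<close>

lemma inertia_cyc_form_pair_split:
  "inertia (cyc_form (- 1) [a, b]) =
    (of_bool (a > 0) + of_bool (b > 0), of_bool (a < 0) + of_bool (b < 0), of_bool (a = 0) + of_bool (b = 0))"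
proof -
  have "cyc_form (- 1) [a, b] = mat_diag 2 (\<lambda>i. real_of_int (if i = 0 then a else b))"
    by (rule eq_matI) (auto simp: cyc_form_pair mat_diag_def)
  moreover have "card {i :: nat. i < 2 \<and> P (real_of_int (if i = 0 then a else b))}
      = of_bool (P a) + of_bool (P b)" for P :: "real \<Rightarrow> bool"
  proof -
    have "{i :: nat. i < 2 \<and> P (real_of_int (if i = 0 then a else b))}
        = (if P a then {0} else {}) \<union> (if P b then {1 :: nat} else {})"
      by (auto simp: less_Suc_eq numeral_2_eq_2)
    then show ?thesis by simp
  qed
  note this[of "\<lambda>x. x > 0"] this[of "\<lambda>x. x < 0"] this[of "\<lambda>x. x = 0"]
  ultimately show ?thesis
    by (simp only: inertia_mat_diag) simp
qed

lemma inertia_cyc_form_0_nonpos: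
  assumes "w \<le> 0"
  shows "inertia (cyc_form 1 [0, w]) = (1, 1, 0)"
proof (rule inertia_indefinite_2)
  \<comment> \<open>The form takes the values \<open>4 - 3 * w\<close> and \<open>w - 4\<close> at
    these vectors.\<close>
  let ?v = "vec 2 (\<lambda>i. if i = 0 then 1 - real_of_int w else 1)"
  let ?w = "vec 2 (\<lambda>i. if i = 0 then - 1 else 1 :: real)"
  show "?v \<bullet> (cyc_form 1 [0, w] *\<^sub>v ?v) > 0" "?w \<bullet> (cyc_form 1 [0, w] *\<^sub>v ?w) < 0"
    using assms by (auto simp: cyc_form_pair scalar_prod_def numeral_2_eq_2 algebra_simps)
qed (use cyc_form_carrier[of 1 "[0, w]"] in \<open>auto simp: numeral_2_eq_2\<close>)

lemma inertia_cyc_form_minus_ones: "inertia (cyc_form 1 [- 1, - 1]) = (1, 1, 0)"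
proof (rule inertia_indefinite_2)
  \<comment> \<open>The values at these vectors are 2 and -6.\<close>
  let ?v = "vec 2 (\<lambda>i. 1 :: real)"
  let ?w = "vec 2 (\<lambda>i. if i = 0 then - 1 else 1 :: real)"
  show "?v \<bullet> (cyc_form 1 [- 1, - 1] *\<^sub>v ?v) > 0" "?w \<bullet> (cyc_form 1 [- 1, - 1] *\<^sub>v ?w) < 0"
    by (auto simp: cyc_form_pair scalar_prod_def numeral_2_eq_2)
qed (use cyc_form_carrier[of 1 "[- 1, - 1]"] in \<open>auto simp: numeral_2_eq_2\<close>)

section \<open>Stripping zeros from the standard cycles\<close>

lemma replicate_split:
  "n = m + k \<Longrightarrow> replicate n x @ ys = replicate m x @ (replicate k x @ ys)"
  by (simp add: replicate_add)

theorem proposition4p13: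
  shows
    "(\<forall>l::nat. l \<ge> 1 \<longrightarrow> circ_inertia (zeros (4*l)) = (2*l - 1, 2*l - 1, 2)) \<and>
     (\<forall>l::nat. circ_inertia (zeros (4*l + 1)) = (2*l + 1, 2*l, 0)) \<and>
     (\<forall>l::nat. circ_inertia (zeros (4*l + 2)) = (2*l + 1, 2*l + 1, 0)) \<and>
     (\<forall>l::nat. circ_inertia (zeros (4*l + 3)) = (2*l + 1, 2*l + 2, 0)) \<and>

     (\<forall>(k::nat) (w::int). w \<le> 0 \<and> \<not> (\<exists>l::nat. 2*k = 4*l \<and> -2 \<le> w \<and> w \<le> 0) \<longrightarrow>
        circ_inertia (zeros (2*k) @ [w]) = (k, k + 1, 0)) \<and>
     (\<forall>l::nat. circ_inertia (zeros (4*l) @ [-1]) = (2*l + 1, 2*l, 0)) \<and>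
     (\<forall>(l::nat) (w::int). w \<le> 0 \<longrightarrow>
        circ_inertia (zeros (4*l + 1) @ [w]) = (2*l + 1, 2*l + 1, 0)) \<and>
     (\<forall>(l::nat) (w::int). w < 0 \<longrightarrow>
        circ_inertia (zeros (4*l + 3) @ [w]) = (2*l + 1, 2*l + 2, 1)) \<and>

     (\<forall>l::nat. circ_inertia (zeros (4*l) @ [-1, -1]) = (2*l + 1, 2*l + 1, 0)) \<and>
     (\<forall>l::nat. circ_inertia (zeros (4*l + 2) @ [-1, -1]) = (2*l + 1, 2*l + 3, 0)) \<and>
     (\<forall>(k::nat) (n::nat) (ws::int list).
        n \<ge> 2 \<and> length ws = n \<and> (\<forall>w \<in> set ws. w \<le> -2) \<and>
        \<not> (\<exists>l::nat. 2*k = 4*l \<and> ws = replicate n (-2)) \<longrightarrow>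
        circ_inertia (zeros (2*k) @ ws) = (k, k + n, 0)) \<and>
     (\<forall>(l::nat) (n::nat). n \<ge> 2 \<longrightarrow>
        circ_inertia (zeros (4*l) @ replicate n (-2)) = (2*l, 2*l + n - 1, 1))"
proof (intro conjI allI impI)
  \<comment> \<open>Removing \<open>4 * l\<close> zeros restores the closing sign 1, whereas
    removing \<open>4 * l + 2\<close> zeros leaves the sign -1. Each case below removes as many
    zeros as leave a nonempty cycle of known inertia.\<close>
  have even: "circ_inertia (zeros (4 * l) @ ws) = (2 * l + p, 2 * l + q, z)"
    if "ws \<noteq> []" "inertia (cyc_form 1 ws) = (p, q, z)" for l ws p q z
    using circ_inertia_even_zeros[of ws "2 * l" p q z] that by simp
  have odd: "circ_inertia (zeros (4 * l + 2) @ ws) = (2 * l + 1 + p, 2 * l + 1 + q, z)"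
    if "ws \<noteq> []" "inertia (cyc_form (- 1) ws) = (p, q, z)" for l ws p q z
    using circ_inertia_even_zeros[of ws "2 * l + 1" p q z] that by (simp add: algebra_simps)
  \<comment> \<open>Two zeros are kept. With closing sign -1 their form is identically 0, which
    accounts for the two zero eigenvalues.\<close>
  show "circ_inertia (zeros (4 * l)) = (2 * l - 1, 2 * l - 1, 2)" if l: "1 \<le> l" for l
  proof -
    obtain l' where "l = Suc l'" using l by (cases l) auto
    then show ?thesis
      using odd[OF _ inertia_cyc_form_pair_split[of 0 0], of l']
        replicate_split[of "4 * l" "4 * l' + 2" 2 "0 :: int" "[]"]
      by (simp add: numeral_2_eq_2)
  qed
  \<comment> \<open>The single zero that is kept has the form \<open>0 + 2\<close>; for
    \<open>4 * l + 3\<close> zeros it has \<open>0 - 2\<close>.\<close>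
  show "circ_inertia (zeros (4 * l + 1)) = (2 * l + 1, 2 * l, 0)" for l
    using even[OF _ inertia_cyc_form_singleton[of 1 0], of l]
      replicate_split[of "4 * l + 1" "4 * l" 1 "0 :: int" "[]"] by simp
  show "circ_inertia (zeros (4 * l + 2)) = (2 * l + 1, 2 * l + 1, 0)" for l
    using even[OF _ inertia_cyc_form_0_nonpos[of 0], of l]
      replicate_split[of "4 * l + 2" "4 * l" 2 "0 :: int" "[]"] by (simp add: numeral_2_eq_2)
  show "circ_inertia (zeros (4 * l + 3)) = (2 * l + 1, 2 * l + 2, 0)" for l
    using odd[OF _ inertia_cyc_form_singleton[of "- 1" 0], of l]
      replicate_split[of "4 * l + 3" "4 * l + 2" 1 "0 :: int" "[]"] by simp
  show "circ_inertia (zeros (4 * l) @ [- 1]) = (2 * l + 1, 2 * l, 0)" for l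
    using even[OF _ inertia_cyc_form_singleton[of 1 "- 1"], of l] by simp
  show "circ_inertia (zeros (4 * l + 1) @ [w]) = (2 * l + 1, 2 * l + 1, 0)" if "w \<le> 0" for l w
    using even[OF _ inertia_cyc_form_0_nonpos[OF that], of l]
      replicate_split[of "4 * l + 1" "4 * l" 1 "0 :: int" "[w]"] by simp
  \<comment> \<open>The remaining pair has the diagonal form with entries 0 and \<open>w\<close>;
    the 0 is the null direction.\<close>
  show "circ_inertia (zeros (4 * l + 3) @ [w]) = (2 * l + 1, 2 * l + 2, 1)" if "w < 0" for l w
    using odd[OF _ inertia_cyc_form_pair_split[of 0 w], of l] that
      replicate_split[of "4 * l + 3" "4 * l + 2" 1 "0 :: int" "[w]"] by simp
  show "circ_inertia (zeros (4 * l) @ [- 1, - 1]) = (2 * l + 1, 2 * l + 1, 0)" for l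
    using even[OF _ inertia_cyc_form_minus_ones, of l] by simp
  show "circ_inertia (zeros (4 * l + 2) @ [- 1, - 1]) = (2 * l + 1, 2 * l + 3, 0)" for l
    using odd[OF _ inertia_cyc_form_pair_split[of "- 1" "- 1"], of l] by simp
  have four: "\<exists>l. 2 * k = 4 * l" if "even k" for k :: nat
    using that by (auto elim!: evenE)
  \<comment> \<open>The remaining entry is \<open>w + 2\<close> for even \<open>k\<close>, where the
    exclusion forces \<open>w < - 2\<close>, and \<open>w - 2\<close> for odd \<open>k\<close>; both
    are negative.\<close>
  show "circ_inertia (zeros (2 * k) @ [w]) = (k, k + 1, 0)"
    if "w \<le> 0 \<and> \<not> (\<exists>l::nat. 2 * k = 4 * l \<and> - 2 \<le> w \<and> w \<le> 0)" for k w
  proof (cases "even k")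
    case True
    then have "w < - 2" using that four by force
    then have "inertia (cyc_form ((- 1) ^ k) [w]) = (0, 1, 0)"
      using True by (simp add: inertia_cyc_form_singleton)
    then show ?thesis using circ_inertia_even_zeros[of "[w]" k] by simp
  next
    case False
    then have "inertia (cyc_form ((- 1) ^ k) [w]) = (0, 1, 0)"
      using that by (simp add: inertia_cyc_form_singleton)
    then show ?thesis using circ_inertia_even_zeros[of "[w]" k] by simp
  qed
  show "circ_inertia (zeros (2 * k) @ ws) = (k, k + n, 0)"
    if *: "2 \<le> n \<and> length ws = n \<and> (\<forall>w\<in>set ws. w \<le> - 2) \<and>
      \<not> (\<exists>l::nat. 2 * k = 4 * l \<and> ws = replicate n (- 2))" for k n ws
  proof -
    have "ws \<noteq> []" using * by auto
    \<comment> \<open>For even \<open>k\<close> the sign is 1, and the exclusion of the all -2 list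
      provides a weight below -2.\<close>
    have "(- 1) ^ k = (- 1 :: real) \<or> (- 1) ^ k = (1 :: real) \<and> (\<exists>w\<in>set ws. w < - 2)"
    proof (cases "even k")
      case True
      then have "ws \<noteq> replicate n (- 2)" using * four by blast
      then obtain w where "w \<in> set ws" "w \<noteq> - 2" using * replicate_eqI[of ws n "- 2"] by blast
      then show ?thesis using * True by force
    qed simp
    then have "inertia (cyc_form ((- 1) ^ k) ws) = (0, n, 0)"
      using inertia_cyc_form_neg_def[OF \<open>ws \<noteq> []\<close>] * by blast
    then show ?thesis using circ_inertia_even_zeros[OF \<open>ws \<noteq> []\<close>] by simp
  qed
  show "circ_inertia (zeros (4 * l) @ replicate n (- 2)) = (2 * l, 2 * l + n - 1, 1)"
    if "2 \<le> n" for l n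
    using even[OF _ inertia_cyc_form_minus_twos[of n], of l] that by (cases n) auto
qed

end
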